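(* Let $T_0\geq10^{30}$. Let $\mathfrak{a}_1=\mathfrak{a}_1(T_0)$, $\mathfrak{a}_2=\mathfrak{a}_2(T_0)$, $\mathfrak{a}_3=\mathfrak{a}_3(T_0)$ be real constants such that for every real $t\geq T_0$ and every positive integer $N$ with $0.9\,t\leq N\leq1.1\,t$, $$\left|E(t)-\Sigma_1(t,N)-\Sigma_2(t,N)\right|\leq\mathfrak{a}_1\log^2t+\mathfrak{a}_2\log t+\mathfrak{a}_3.$$ Define $$\mathfrak{a}(T_0)=2.111+\frac{25.4\log\log T_0}{\log T_0}+\frac{|\mathfrak{a}_1|\sqrt{\pi\log T_0}}{T_0^{1/3}}+\frac{|\mathfrak{a}_2|\sqrt{\pi}}{T_0^{1/3}\sqrt{\log T_0}}+\frac{|\mathfrak{a}_3|\sqrt{\pi}+6.741}{T_0^{1/3}(\log T_0)^{3/2}}.$$ Then $$|E(T)|\leq\left(\frac{1}{\sqrt\pi}\,\mathfrak{a}(T_0)+1+\frac{2.001}{(\log T_0)^{1/3}}\right)T^{1/3}(\log T)^{5/3}$$ for all $T\geq1.1\,T_0$.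
   Context: $\zeta$ is the Riemann zeta-function, $\gamma$ is the Euler--Mascheroni constant, $d(n)$ is the number of positive divisors of $n$, $\log$ is the natural logarithm. For $T\geq2$, $E(T)$ is defined by $$\int_0^T\left|\zeta\left(\tfrac12+it\right)\right|^2dt=T\log T-\left(1+\log 2\pi-2\gamma\right)T+E(T).$$ For $T>0$ and a positive integer $N$, $$\Sigma_1(T,N)=\sqrt2\left(\frac{T}{2\pi}\right)^{1/4}\sum_{n\leq N}(-1)^n\frac{d(n)}{n^{3/4}}e(T,n)\cos f(T,n),$$ $$\Sigma_2(T,N)=-2\sum_{n\leq\mathcal{Z}(T,N)}\frac{d(n)}{n^{1/2}}\left(\log\frac{T}{2\pi n}\right)^{-1}\cos g(T,n),$$ where sums run over positive integers $n$, and $$\mathcal{Z}(T,N)=\frac14\left(\sqrt{N+\tfrac12+\tfrac{2T}{\pi}}-\sqrt{N+\tfrac12}\right)^2,$$ $$e(T,n)=\left(1+\frac{\pi n}{2T}\right)^{-1/4}\left(\frac{2T}{\pi n}\right)^{-1/2}\left(\operatorname{arsinh}\sqrt{\frac{\pi n}{2T}}\right)^{-1},$$ $$f(T,n)=2T\operatorname{arsinh}\sqrt{\frac{\pi n}{2T}}+\sqrt{(\pi n)^2+2\pi nT}-\frac{\pi}{4},\qquad g(T,n)=T\log\frac{T}{2\pi n}-T+\frac{\pi}{4}.$$ *)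

theory Defs
  imports "HOL-Complex_Analysis.Complex_Analysis"
begin

section \<open>The Riemann zeta function\<close>

definition is_zeta :: "(complex \<Rightarrow> complex) \<Rightarrow> bool" where
  "is_zeta f \<longleftrightarrow>
     f holomorphic_on - {1} \<and>
     (\<forall>s. Re s > 1 \<longrightarrow> (\<lambda>n. of_nat (Suc n) powr (- s)) sums f s) \<and>
     f 1 = 0"

text \<open>
  The value at the pole is fixed to be 0 by convention, which makes the analytic continuation
  unique as a total function; existence and uniqueness are shown in \<open>ex1_is_zeta\<close> below.
\<close>
definition zeta :: "complex \<Rightarrow> complex" where
  "zeta = (THE f. is_zeta f)"

lemma Dirichlet_type_holomorphic:
  fixes f :: "nat \<Rightarrow> complex \<Rightarrow> complex" and c :: real
  assumes hol: "\<And>n. f n holomorphic_on {s. Re s > c}"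
    and bd: "\<And>s d. 0 < d \<Longrightarrow> c < Re s - d \<Longrightarrow>
       \<exists>C p. 1 < p \<and> (\<forall>n. \<forall>w\<in>ball s d. norm (f n w) \<le> C * real (Suc n) powr (- p))"
  shows "\<exists>g. g holomorphic_on {s. Re s > c} \<and> (\<forall>s. Re s > c \<longrightarrow> (\<lambda>n. f n s) sums g s)"
proof -
  let ?S = "{s. Re s > c}"
  have op: "open ?S" by (simp add: open_halfspace_Re_gt)
  have "\<exists>g g'. \<forall>x\<in>?S. ((\<lambda>n. f n x) sums g x) \<and> ((\<lambda>n. deriv (f n) x) sums g' x) \<and>
          (g has_field_derivative g' x) (at x)"
  proof (rule series_and_derivative_comparison_local[OF op])
    fix n x assume "x \<in> ?S"
    then show "(f n has_field_derivative deriv (f n) x) (at x)"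
      using hol op holomorphic_derivI by blast
  next
    fix s assume s: "s \<in> ?S"
    define d where "d = (Re s - c) / 2"
    have d: "0 < d" "c < Re s - d" using s by (auto simp: d_def field_simps)
    obtain C p where Cp: "1 < p" "\<And>n w. w \<in> ball s d \<Longrightarrow> norm (f n w) \<le> C * real (Suc n) powr (- p)"
      using bd[OF d] by blast
    define h where "h = (\<lambda>n. C * real (Suc n) powr (- p))"
    have "summable (\<lambda>n. real n powr (- p))" using Cp(1) by (simp add: summable_real_powr_iff)
    then have "summable (\<lambda>n. real (Suc n) powr (- p))" by (rule summable_ignore_initial_segment[of _ 1, simplified])
    then have sh: "summable h" unfolding h_def by (rule summable_mult)
    show "\<exists>d h. 0 < d \<and> summable h \<and>
        (\<forall>\<^sub>F n in sequentially. \<forall>y\<in>ball s d \<inter> ?S. norm (f n y) \<le> h n)"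
      using d(1) sh Cp(2) unfolding h_def
      by (intro exI[of _ d] exI[of _ h] conjI always_eventually) (auto simp: h_def simp del: of_nat_Suc)
  qed
  then obtain g g' where g: "\<And>x. x \<in> ?S \<Longrightarrow> ((\<lambda>n. f n x) sums g x)"
      "\<And>x. x \<in> ?S \<Longrightarrow> (g has_field_derivative g' x) (at x)" by blast
  have "g holomorphic_on ?S"
    using g(2) by (auto simp: holomorphic_on_open[OF op])
  then show ?thesis using g(1) by auto
qed

lemma norm_nat_powr: "norm (of_nat (Suc n) powr (s::complex)) = real (Suc n) powr Re s"
  using norm_powr_real_powr[of "of_nat (Suc n)" s]
  by (simp del: of_nat_Suc)

lemma Dirichlet_series_zeta:
  "\<exists>g. g holomorphic_on {s. Re s > 1} \<and>
     (\<forall>s. Re s > 1 \<longrightarrow> (\<lambda>n. of_nat (Suc n) powr (- s)) sums g s)"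
proof (rule Dirichlet_type_holomorphic)
  show "(\<lambda>s. of_nat (Suc n) powr (- s)) holomorphic_on {s. Re s > 1}" for n
    by (intro holomorphic_intros)
next
  fix s :: complex and d :: real
  assume d: "0 < d" "1 < Re s - d"
  show "\<exists>C p. 1 < p \<and> (\<forall>n. \<forall>w\<in>ball s d. norm (of_nat (Suc n) powr (- w) :: complex) \<le> C * real (Suc n) powr (- p))"
  proof (rule exI[of _ 1], rule exI[of _ "Re s - d"], intro conjI d allI ballI)
    fix n w assume "w \<in> ball s d"
    then have "Re s - d \<le> Re w"
      using abs_Re_le_cmod[of "s - w"] by (auto simp: dist_norm)
    then show "norm (of_nat (Suc n) powr (- w) :: complex) \<le> 1 * real (Suc n) powr (- (Re s - d))"
      unfolding norm_nat_powr by (simp del: of_nat_Suc add: powr_mono)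
  qed
qed

text \<open>
  Continuation strip by strip: expand \<open>(x + 1) powr (1 - s) - x powr (1 - s)\<close> by Taylor's formula
  and sum over \<open>x = 1, 2, \<dots>\<close>; the left-hand sides telescope.
\<close>

definition falling :: "nat \<Rightarrow> complex \<Rightarrow> complex" where
  "falling i s = (\<Prod>l<i. 1 - s - of_nat l)"

definition taylor_rem :: "nat \<Rightarrow> nat \<Rightarrow> complex \<Rightarrow> complex" where
  "taylor_rem J n s = of_nat (Suc (Suc n)) powr (1 - s) -
     (\<Sum>i\<le>J. falling i s * of_nat (Suc n) powr (1 - s - of_nat i) / fact i)"

lemma taylor_rem_bound:
  assumes "Re s > 1 - real J"
  shows "norm (taylor_rem J n s) \<le> norm (falling (Suc J) s) * real (Suc n) powr (- Re s - real J)"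
proof -
  define x where "x = real (Suc n)"
  have x: "x > 0" by (simp add: x_def)
  define S where "S = closed_segment (complex_of_real x) (complex_of_real (x + 1))"
  have S: "\<exists>t\<ge>x. z = complex_of_real t" if "z \<in> S" for z
    using that unfolding S_def closed_segment_of_real closed_segment_eq_real_ivl by auto
  define F where "F = (\<lambda>i z. falling i s * z powr (1 - s - of_nat i))"
  define B where "B = norm (falling (Suc J) s) * x powr (- Re s - real J)"
  have "norm (F 0 (of_real (x+1)) - (\<Sum>i\<le>J. F i (of_real x) * (of_real (x+1) - of_real x) ^ i / fact i))
      \<le> B * norm (complex_of_real (x+1) - of_real x) ^ Suc J / fact J"
  proof (rule complex_Taylor)
    show "convex S" "of_real x \<in> S" "of_real (x+1) \<in> S" by (auto simp: S_def)
  next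
    fix i z assume z: "z \<in> S" "i \<le> J"
    then obtain t where t: "t \<ge> x" "z = of_real t" using S by blast
    have "z \<notin> \<real>\<^sub>\<le>\<^sub>0" using t x by auto
    then have "((\<lambda>z. falling i s * z powr (1 - s - of_nat i)) has_field_derivative
        falling i s * ((1 - s - of_nat i) * z powr (1 - s - of_nat i - 1))) (at z)"
      by (intro DERIV_cmult has_field_derivative_powr)
    also have "falling i s * ((1 - s - of_nat i) * z powr (1 - s - of_nat i - 1)) = F (Suc i) z"
      by (simp add: F_def falling_def algebra_simps)
    finally show "(F i has_field_derivative F (Suc i) z) (at z within S)"
      unfolding F_def using has_field_derivative_at_within by blast
  next
    fix z assume z: "z \<in> S"
    then obtain t where t: "t \<ge> x" "z = of_real t" using S by blast
    have "norm (z powr (1 - s - of_nat (Suc J))) = t powr (- Re s - real J)"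
      using t x norm_powr_real_powr[of z "1 - s - of_nat (Suc J)"] by simp
    also have "\<dots> \<le> x powr (- Re s - real J)"
      using t x assms by (intro powr_mono2') auto
    finally show "norm (F (Suc J) z) \<le> B"
      unfolding F_def B_def norm_mult by (intro mult_left_mono) auto
  qed
  also have "\<dots> = B / fact J" by simp
  also have "\<dots> \<le> B"
  proof -
    have "B \<ge> 0" by (simp add: B_def)
    then show ?thesis using divide_left_mono[of 1 "fact J" B] by (simp add: fact_ge_1)
  qed
  also have "F 0 (of_real (x+1)) - (\<Sum>i\<le>J. F i (of_real x) * (of_real (x+1) - of_real x) ^ i / fact i)
     = taylor_rem J n s"
    unfolding taylor_rem_def F_def x_def by (simp add: falling_def add_ac)
  finally show ?thesis unfolding B_def x_def .
qed

lemma taylor_rem_sums: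
  "\<exists>g. g holomorphic_on {s. Re s > 1 - real J} \<and>
     (\<forall>s. Re s > 1 - real J \<longrightarrow> (\<lambda>n. taylor_rem J n s) sums g s)"
proof (rule Dirichlet_type_holomorphic)
  show "taylor_rem J n holomorphic_on {s. Re s > 1 - real J}" for n
    unfolding taylor_rem_def falling_def
    by (intro holomorphic_intros) (auto simp del: of_nat_Suc)
next
  fix s :: complex and d :: real
  assume d: "0 < d" "1 - real J < Re s - d"
  have "continuous_on (cball s d) (falling (Suc J))"
    unfolding falling_def by (intro continuous_intros)
  then have "bounded (falling (Suc J) ` cball s d)"
    by (intro compact_imp_bounded compact_continuous_image) auto
  then obtain C where C: "\<And>w. w \<in> cball s d \<Longrightarrow> norm (falling (Suc J) w) \<le> C"
    unfolding bounded_iff by (metis imageI)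
  have C0: "C \<ge> 0" using C[of s] d norm_ge_zero[of "falling (Suc J) s"] by (auto simp del: norm_ge_zero intro: order_trans)
  show "\<exists>C p. 1 < p \<and> (\<forall>n. \<forall>w\<in>ball s d. norm (taylor_rem J n w) \<le> C * real (Suc n) powr (- p))"
  proof (rule exI[of _ C], rule exI[of _ "Re s - d + real J"], intro conjI allI ballI)
    show "1 < Re s - d + real J" using d by simp
    fix n w assume w: "w \<in> ball s d"
    then have *: "Re s - d \<le> Re w"
      using abs_Re_le_cmod[of "s - w"] by (auto simp: dist_norm)
    then have "norm (taylor_rem J n w) \<le> norm (falling (Suc J) w) * real (Suc n) powr (- Re w - real J)"
      using d by (intro taylor_rem_bound) auto
    also have "\<dots> \<le> C * real (Suc n) powr (- (Re s - d + real J))"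
    proof (rule mult_mono)
      show "norm (falling (Suc J) w) \<le> C" using w by (intro C) auto
      show "real (Suc n) powr (- Re w - real J) \<le> real (Suc n) powr (- (Re s - d + real J))"
        using * by (intro powr_mono) auto
    qed (use C0 in auto)
    finally show "norm (taylor_rem J n w) \<le> C * real (Suc n) powr (- (Re s - d + real J))" .
  qed
qed

lemma zeta_continuation_strip:
  assumes D: "\<And>s. Re s > 1 \<Longrightarrow> (\<lambda>n. of_nat (Suc n) powr (- s)) sums D s"
    and holD: "D holomorphic_on {s. Re s > 1}"
  shows "\<exists>Z. Z holomorphic_on {s. Re s > 1 - real K} \<and> (\<forall>s. Re s > 1 \<longrightarrow> Z s = (s - 1) * D s)"
proof (induction K)
  case 0
  show ?case using holD by (intro exI[of _ "\<lambda>s. (s - 1) * D s"]) (auto intro!: holomorphic_intros)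
next
  case (Suc K)
  then obtain Z where Z: "Z holomorphic_on {s. Re s > 1 - real K}" "\<And>s. Re s > 1 \<Longrightarrow> Z s = (s - 1) * D s"
    by blast
  obtain R where R: "R holomorphic_on {s. Re s > 1 - real (Suc K)}"
     "\<And>s. Re s > 1 - real (Suc K) \<Longrightarrow> (\<lambda>n. taylor_rem (Suc K) n s) sums R s"
    using taylor_rem_sums by blast
  define W where "W = (\<lambda>s. 1 + R s - (\<Sum>i<K. falling (Suc i) s / fact (i + 2) * Z (s + of_nat (Suc i))))"
  have "W holomorphic_on {s. Re s > 1 - real (Suc K)}"
    unfolding W_def falling_def
    by (intro holomorphic_intros R holomorphic_on_compose_gen[OF _ Z(1), unfolded o_def]) auto
  moreover have "W s = (s - 1) * D s" if s: "Re s > 1" for s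
  proof -
    have t0: "(\<lambda>n. of_nat (Suc n) powr (1 - s)) \<longlonglongrightarrow> 0"
    proof (rule tendsto_norm_zero_cancel, unfold norm_nat_powr)
      have "(\<lambda>n. real n powr Re (1 - s)) \<longlonglongrightarrow> 0"
        using s by (intro tendsto_neg_powr filterlim_real_sequentially) auto
      then show "(\<lambda>n. real (Suc n) powr Re (1 - s)) \<longlonglongrightarrow> 0"
        by (rule LIMSEQ_Suc)
    qed
    have tel: "(\<lambda>n. of_nat (Suc (Suc n)) powr (1 - s) - of_nat (Suc n) powr (1 - s)) sums (0 - 1)"
      using telescope_sums[OF t0] by simp
    have mid: "(\<lambda>n. falling i s * of_nat (Suc n) powr (1 - s - of_nat i) / fact i)
        sums (falling i s / fact i * D (s + of_nat i - 1))" if "i \<ge> 1" for i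
    proof -
      have "Re (s + of_nat i - 1) > 1" using s that by simp
      from sums_mult[OF D[OF this], of "falling i s / fact i"] show ?thesis
        by (simp add: algebra_simps del: of_nat_Suc)
    qed
    have "(\<lambda>n. (of_nat (Suc (Suc n)) powr (1 - s) - of_nat (Suc n) powr (1 - s))
        - (\<Sum>i=1..Suc K. falling i s * of_nat (Suc n) powr (1 - s - of_nat i) / fact i))
       sums ((0 - 1) - (\<Sum>i=1..Suc K. falling i s / fact i * D (s + of_nat i - 1)))"
      by (intro sums_diff tel sums_sum mid) auto
    moreover have "(\<lambda>n. (of_nat (Suc (Suc n)) powr (1 - s) - of_nat (Suc n) powr (1 - s))
        - (\<Sum>i=1..Suc K. falling i s * of_nat (Suc n) powr (1 - s - of_nat i) / fact i))
       = (\<lambda>n. taylor_rem (Suc K) n s)"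
    proof
      fix n
      have "{..Suc K} = insert 0 {1..Suc K}" by auto
      then show "(of_nat (Suc (Suc n)) powr (1 - s) - of_nat (Suc n) powr (1 - s))
        - (\<Sum>i=1..Suc K. falling i s * of_nat (Suc n) powr (1 - s - of_nat i) / fact i)
          = taylor_rem (Suc K) n s"
        unfolding taylor_rem_def by (simp add: falling_def del: of_nat_Suc sum.atLeast_Suc_atMost sum.cl_ivl_Suc)
    qed
    ultimately have "(\<lambda>n. taylor_rem (Suc K) n s) sums
        ((0 - 1) - (\<Sum>i=1..Suc K. falling i s / fact i * D (s + of_nat i - 1)))" by simp
    then have Rs: "R s = (0 - 1) - (\<Sum>i=1..Suc K. falling i s / fact i * D (s + of_nat i - 1))"
      using R(2)[of s] s sums_unique2 by force
    have "(\<Sum>i=1..Suc K. falling i s / fact i * D (s + of_nat i - 1))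
        = (\<Sum>i<Suc K. falling (Suc i) s / fact (Suc i) * D (s + of_nat i))"
      by (rule sum.reindex_bij_witness[of _ Suc "\<lambda>i. i - 1"]) (auto simp: algebra_simps of_nat_diff)
    also have "\<dots> = falling 1 s * D s + (\<Sum>i<K. falling (i + 2) s / fact (i + 2) * D (s + of_nat (Suc i)))"
      unfolding sum.lessThan_Suc_shift by (simp add: o_def)
    also have "(\<Sum>i<K. falling (i + 2) s / fact (i + 2) * D (s + of_nat (Suc i)))
        = - (\<Sum>i<K. falling (Suc i) s / fact (i + 2) * Z (s + of_nat (Suc i)))"
      unfolding sum_negf[symmetric]
    proof (rule sum.cong[OF refl])
      fix i assume "i \<in> {..<K}"
      have "Z (s + of_nat (Suc i)) = (s + of_nat (Suc i) - 1) * D (s + of_nat (Suc i))"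
        using s by (intro Z(2)) auto
      moreover have "falling (i + 2) s = - (falling (Suc i) s * (s + of_nat (Suc i) - 1))"
        by (simp add: falling_def algebra_simps)
      ultimately show "falling (i + 2) s / fact (i + 2) * D (s + of_nat (Suc i))
          = - (falling (Suc i) s / fact (i + 2) * Z (s + of_nat (Suc i)))"
        by (simp only:) (simp only: times_divide_eq_left times_divide_eq_right mult_minus_left minus_divide_left mult.assoc)
    qed
    finally show ?thesis unfolding W_def Rs by (simp add: falling_def algebra_simps)
  qed
  ultimately show ?case by blast
qed

lemma ex_is_zeta: "\<exists>f. is_zeta f"
proof -
  obtain D where holD: "D holomorphic_on {s. Re s > 1}"
    and D: "\<And>s. Re s > 1 \<Longrightarrow> (\<lambda>n. of_nat (Suc n) powr (- s)) sums D s"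
    using Dirichlet_series_zeta by blast
  have "\<forall>K::nat. \<exists>Z. Z holomorphic_on {s. Re s > 1 - real K} \<and> (\<forall>s. Re s > 1 \<longrightarrow> Z s = (s - 1) * D s)"
    using zeta_continuation_strip[OF D holD] by blast
  then obtain Z where Z: "\<And>K::nat. Z K holomorphic_on {s. Re s > 1 - real K}"
     "\<And>K s. Re s > 1 \<Longrightarrow> Z K s = (s - 1) * D s"
    by metis
  have agree: "Z K s = Z L s" if "K \<le> L" "Re s > 1 - real K" for K L s
  proof (rule analytic_continuation_open[of "{s. Re s > 1}" "{s. Re s > 1 - real K}" "Z K" "Z L" s])
    show "{s. Re s > 1} \<noteq> {}" by (auto intro!: exI[of _ 2])
    show "connected {s. Re s > 1 - real K}"
      by (simp add: convex_connected convex_halfspace_Re_gt)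
    show "Z K holomorphic_on {s. Re s > 1 - real K}" by (rule Z)
    show "Z L holomorphic_on {s. Re s > 1 - real K}"
    proof (rule holomorphic_on_subset[OF Z(1)[of L]])
      show "{s. Re s > 1 - real K} \<subseteq> {s. Re s > 1 - real L}" using that(1) by auto
    qed
  qed (use that(2) in \<open>auto simp: open_halfspace_Re_gt Z(2)[of _ K] Z(2)[of _ L]\<close>)
  define N :: "complex \<Rightarrow> nat" where "N = (\<lambda>s. nat \<lceil>2 - Re s\<rceil>)"
  have N: "Re s > 1 - real (N s)" for s
    unfolding N_def by linarith
  define W where "W = (\<lambda>s. Z (N s) s)"
  have W: "W s = Z K s" if "Re s > 1 - real K" for s K
  proof (cases "K \<le> N s")
    case True
    then show ?thesis using agree[of K "N s" s] that by (simp add: W_def)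
  next
    case False
    then show ?thesis using agree[of "N s" K s] N[of s] by (simp add: W_def)
  qed
  have holW: "W holomorphic_on UNIV"
  proof -
    have "W field_differentiable at s" for s
    proof -
      let ?S = "{z. Re z > 1 - real (N s)}"
      have "W holomorphic_on ?S"
        using Z(1)[of "N s"] by (rule holomorphic_transform) (simp add: W[of "N s"])
      then show ?thesis
        using N[of s] holomorphic_on_imp_differentiable_at[of W ?S s]
        by (auto simp: open_halfspace_Re_gt)
    qed
    then show ?thesis
      by (simp add: holomorphic_on_def)
  qed
  define f where "f = (\<lambda>s. if s = 1 then 0 else W s / (s - 1))"
  have "(\<lambda>s. W s / (s - 1)) holomorphic_on - {1}"
    by (intro holomorphic_intros holomorphic_on_subset[OF holW]) auto
  then have "f holomorphic_on - {1}"
    by (rule holomorphic_transform) (auto simp: f_def)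
  moreover have "f s = D s" if "Re s > 1" for s
    using that W[of 0 s] Z(2)[of s 0] by (auto simp: f_def)
  ultimately have "is_zeta f"
    using D by (auto simp: is_zeta_def f_def)
  then show ?thesis by blast
qed

lemma is_zeta_unique:
  assumes "is_zeta f" "is_zeta g"
  shows "f = g"
proof
  fix s
  show "f s = g s"
  proof (cases "s = 1")
    case True
    then show ?thesis using assms by (simp add: is_zeta_def)
  next
    case False
    show ?thesis
    proof (rule analytic_continuation_open[of "{s. Re s > 1}" "- {1}" f g s])
      show "{s. Re s > 1} \<noteq> {}" by (auto intro!: exI[of _ 2])
      show "connected (- {1 :: complex})"
        by (rule connected_punctured_universe) simp
      show "f z = g z" if "z \<in> {s. Re s > 1}" for z
      proof (rule sums_unique2)
        show "(\<lambda>n. of_nat (Suc n) powr (- z)) sums f z" "(\<lambda>n. of_nat (Suc n) powr (- z)) sums g z"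
          using that assms unfolding is_zeta_def by auto
      qed
    qed (use False assms in \<open>auto simp: is_zeta_def open_halfspace_Re_gt\<close>)
  qed
qed

lemma ex1_is_zeta: "\<exists>!f. is_zeta f"
  using ex_is_zeta is_zeta_unique by blast

lemma is_zeta_zeta: "is_zeta zeta"
  unfolding zeta_def by (rule theI'[OF ex1_is_zeta])


section \<open>The error term in the mean square of zeta, and the sums in Atkinson's formula\<close>

definition E :: "real \<Rightarrow> real" where
  "E T = integral {0..T} (\<lambda>t. (norm (zeta (Complex (1/2) t)))\<^sup>2)
         - (T * ln T - (1 + ln (2 * pi) - 2 * euler_mascheroni) * T)"

text \<open>The integral is a genuine one, as the integrand is continuous.\<close>
lemma E_integrand_integrable:
  "(\<lambda>t. (norm (zeta (Complex (1/2) t)))\<^sup>2) integrable_on {0..T}"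
proof (rule integrable_continuous_real)
  have "continuous_on (- {1}) zeta"
    using is_zeta_zeta by (auto simp: is_zeta_def intro: holomorphic_on_imp_continuous_on)
  moreover have "continuous_on {0..T} (\<lambda>t. Complex (1/2) t)"
    by (simp add: Complex_eq continuous_intros)
  moreover have "(\<lambda>t. Complex (1/2) t) ` {0..T} \<subseteq> - {1}"
    by (auto simp: complex_eq_iff)
  ultimately have "continuous_on {0..T} (\<lambda>t. zeta (Complex (1/2) t))"
    by (rule continuous_on_compose2)
  then show "continuous_on {0..T} (\<lambda>t. (norm (zeta (Complex (1/2) t)))\<^sup>2)"
    by (intro continuous_intros)
qed

definition num_divisors :: "nat \<Rightarrow> nat" where
  "num_divisors n = card {k. k dvd n}"

definition e_fun :: "real \<Rightarrow> nat \<Rightarrow> real" where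
  "e_fun T n = (1 + pi * n / (2 * T)) powr (- 1/4) * (2 * T / (pi * n)) powr (- 1/2)
               * inverse (arsinh (sqrt (pi * n / (2 * T))))"

definition f_fun :: "real \<Rightarrow> nat \<Rightarrow> real" where
  "f_fun T n = 2 * T * arsinh (sqrt (pi * n / (2 * T)))
               + sqrt ((pi * n)\<^sup>2 + 2 * pi * n * T) - pi / 4"

definition g_fun :: "real \<Rightarrow> nat \<Rightarrow> real" where
  "g_fun T n = T * ln (T / (2 * pi * n)) - T + pi / 4"

definition Z_cut :: "real \<Rightarrow> nat \<Rightarrow> real" where
  "Z_cut T N = 1/4 * (sqrt (N + 1/2 + 2 * T / pi) - sqrt (N + 1/2))\<^sup>2"

definition Sigma1 :: "real \<Rightarrow> nat \<Rightarrow> real" where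
  "Sigma1 T N = sqrt 2 * (T / (2 * pi)) powr (1/4)
     * (\<Sum>n = 1..N. (- 1) ^ n * (num_divisors n / n powr (3/4)) * e_fun T n * cos (f_fun T n))"

definition Sigma2 :: "real \<Rightarrow> nat \<Rightarrow> real" where
  "Sigma2 T N = - 2 * (\<Sum>n | 1 \<le> n \<and> real n \<le> Z_cut T N.
       num_divisors n / n powr (1/2) * inverse (ln (T / (2 * pi * n))) * cos (g_fun T n))"

definition frak_a :: "real \<Rightarrow> real \<Rightarrow> real \<Rightarrow> real \<Rightarrow> real" where
  "frak_a a1 a2 a3 T0 =
     2.111 + 25.4 * ln (ln T0) / ln T0
     + \<bar>a1\<bar> * sqrt (pi * ln T0) / T0 powr (1/3)
     + \<bar>a2\<bar> * sqrt pi / (T0 powr (1/3) * sqrt (ln T0))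
     + (\<bar>a3\<bar> * sqrt pi + 6.741) / (T0 powr (1/3) * ln T0 powr (3/2))"

end

theory Submission
  imports Defs
begin

text \<open>
  The integral of \<open>\<bar>\<zeta>\<bar>\<^sup>2\<close> increases with its endpoint, so on a short interval \<open>E\<close> can only decrease as
  fast as the elementary main term \<open>T ln T - \<dots>\<close> increases: going from \<open>s\<close> to \<open>t > s\<close> it loses at
  most about \<open>(t - s) ln t\<close> (\<open>E_increment\<close>). Hence \<open>E T\<close> is bounded above by the mean of \<open>E\<close> over
  \<open>[T, T + H]\<close>, and below by its mean over \<open>[T - H, T]\<close>, up to \<open>O(H ln T)\<close>
  (\<open>E_bound_by_averaging\<close>). In these means \<open>E\<close> may be replaced by \<open>\<Sigma>\<^sub>1 + \<Sigma>\<^sub>2\<close> with one fixed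
  \<open>N = \<lfloor>T\<rfloor>\<close>, at the cost of the assumed error.

  Averaging pays because the terms oscillate in \<open>t\<close>. The \<open>n\<close>-th term of \<open>\<Sigma>\<^sub>1\<close> has phase derivative
  \<open>2u\<close>, where \<open>u = arsinh (sqrt (\<pi>n/2t))\<close> is of order \<open>sqrt (n/t)\<close>, and its amplitude is
  \<open>d(n) n^(-1/2) sqrt (tanh u) / u\<close>. The amplitude divided by the phase derivative is monotone in \<open>t\<close>,
  so the second mean value theorem bounds the integral of the term by \<open>O(d(n) n^(-5/4) T^(3/4))\<close>, while
  the size of the integrand gives \<open>O(H d(n) n^(-3/4) T^(1/4))\<close> (\<open>Sigma1_term_integral\<close>). The second
  bound is used for \<open>n \<le> M\<close> and the first one for \<open>n > M\<close>; the divisor sums are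
  \<open>O(M^(1/4) ln T)\<close> and \<open>O(M^(-1/4) ln T)\<close>, and with \<open>H = M = T^(1/3)\<close> both parts of the
  mean are \<open>O(T^(1/3) ln T)\<close>. The phase derivative of each term of \<open>\<Sigma>\<^sub>2\<close> is at least 1, so the
  integral of the whole sum is only \<open>O(T^(1/2) ln T)\<close> (\<open>Sigma2_integral\<close>).

  With explicit constants this gives \<open>\<bar>E T\<bar> \<le> T^(1/3) (24 ln T + 26)\<close> plus the assumed error. The claim
  has \<open>(ln T)^(5/3)\<close> in place of \<open>ln T\<close>. As \<open>ln T \<ge> 64\<close>, this is a gain of \<open>(ln T)^(2/3) \<ge> 16\<close>, and since
  \<open>2.111 / sqrt \<pi> + 1 \<ge> 2\<close> the right-hand side is at least \<open>32 T^(1/3) ln T\<close>. The \<open>a\<^sub>i\<close>-terms of the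
  claim exceed the assumed error because \<open>(ln T)^(1/6) \<ge> 2\<close>.
\<close>

section \<open>Integrals of oscillating functions\<close>

text \<open>
  Since \<open>ph' cos ph\<close> is the derivative of \<open>sin ph\<close>, its integral over any subinterval is at most 2 in
  absolute value, however long the interval is; the second mean value theorem brings in the monotone
  factor \<open>G\<close>. The bound keeps the values of \<open>G\<close> apart, so that it becomes \<open>2 G b\<close> for \<open>G \<ge> 0\<close> and
  \<open>- 2 G a\<close> for \<open>G \<le> 0\<close>.
\<close>
lemma cos_phase_integral:
  fixes G ph ph' :: "real \<Rightarrow> real"
  assumes ab: "a \<le> b"
    and G: "\<And>x y. a \<le> x \<Longrightarrow> x \<le> y \<Longrightarrow> y \<le> b \<Longrightarrow> G x \<le> G y"
    and ph: "\<And>x. a \<le> x \<Longrightarrow> x \<le> b \<Longrightarrow> (ph has_real_derivative ph' x) (at x)"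
  obtains I where "((\<lambda>x. G x * (ph' x * cos (ph x))) has_integral I) {a..b}"
    "\<bar>I\<bar> \<le> \<bar>G a\<bar> + \<bar>G b\<bar> + (G b - G a)"
proof -
  let ?f = "\<lambda>x. ph' x * cos (ph x)"
  have F: "(?f has_integral (sin (ph d) - sin (ph c))) {c..d}"
    if "a \<le> c" "c \<le> d" "d \<le> b" for c d
  proof (rule fundamental_theorem_of_calculus[OF that(2)])
    fix x assume x: "x \<in> {c..d}"
    have "((\<lambda>x. sin (ph x)) has_real_derivative cos (ph x) * ph' x) (at x within {c..d})"
      using x that by (intro DERIV_subset[OF DERIV_chain2[OF DERIV_sin ph]]) auto
    then show "((\<lambda>x. sin (ph x)) has_vector_derivative ?f x) (at x within {c..d})"
      unfolding has_real_derivative_iff_has_vector_derivative by (simp only: mult.commute)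
  qed
  obtain c where c: "c \<in> {a..b}"
    and I: "((\<lambda>x. G x * ?f x) has_integral
              (G a * integral {a..c} ?f + G b * integral {c..b} ?f)) {a..b}"
    by (rule second_mean_value_theorem_full[OF
          has_integral_integrable[OF F[OF order_refl ab order_refl]] ab G]) auto
  have 1: "integral {a..c} ?f = sin (ph c) - sin (ph a)" "integral {c..b} ?f = sin (ph b) - sin (ph c)"
    using F c by (auto intro!: integral_unique)
  have "\<bar>G a * integral {a..c} ?f + G b * integral {c..b} ?f\<bar>
     = \<bar>G b * sin (ph b) - G a * sin (ph a) - (G b - G a) * sin (ph c)\<bar>"
    unfolding 1 by (simp add: algebra_simps)
  also have "\<dots> \<le> \<bar>G b * sin (ph b)\<bar> + \<bar>G a * sin (ph a)\<bar> + \<bar>(G b - G a) * sin (ph c)\<bar>"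
    by linarith
  also have "\<dots> \<le> \<bar>G b\<bar> + \<bar>G a\<bar> + \<bar>G b - G a\<bar>"
    unfolding abs_mult by (intro add_mono mult_right_le_one_le) auto
  also have "\<bar>G b - G a\<bar> = G b - G a" using G[of a b] ab by simp
  finally show ?thesis using I that by (simp add: add_ac)
qed

text \<open>
  The sign of the derivative comes from \<open>x \<le> sinh x cosh x\<close>. This lemma makes the amplitude of a term
  of \<open>\<Sigma>\<^sub>1\<close>, divided by the derivative of its phase, a monotone function of \<open>t\<close>.
\<close>
lemma tanh_div_antimono:
  fixes v w :: real
  assumes "0 < v" "v \<le> w"
  shows "tanh w / w \<le> tanh v / v"
proof -
  have "\<exists>y. ((\<lambda>x. tanh x / x) has_real_derivative y) (at x) \<and> y \<le> 0" if "v \<le> x" for x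
  proof (intro exI conjI)
    have x: "x > 0" using that assms by simp
    show "((\<lambda>x. tanh x / x) has_real_derivative ((1 - (tanh x)\<^sup>2) * x - tanh x * 1) / (x * x)) (at x)"
      using x by (intro DERIV_divide DERIV_ident
          has_field_derivative_tanh[OF _ DERIV_ident, unfolded mult_1_right]) auto
    have "x \<le> sinh x"
    proof -
      have "sinh 0 - 0 \<le> sinh x - x"
      proof (rule DERIV_nonneg_imp_nondecreasing[of 0 x "\<lambda>x. sinh x - x"])
        show "\<exists>y. ((\<lambda>x. sinh x - x) has_real_derivative y) (at z) \<and> 0 \<le> y" for z :: real
          by (rule exI[of _ "cosh z - 1"])
            (auto intro!: DERIV_diff DERIV_ident has_field_derivative_sinh[OF DERIV_ident, unfolded mult_1_right] cosh_real_ge_1)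
      qed (use x in simp)
      then show ?thesis by simp
    qed
    also have "\<dots> \<le> sinh x * cosh x" using x by (simp add: cosh_real_ge_1)
    finally have "x / (cosh x)\<^sup>2 \<le> tanh x"
      by (simp add: tanh_def field_simps power2_eq_square cosh_real_pos)
    moreover have "1 - (tanh x)\<^sup>2 = 1 / (cosh x)\<^sup>2"
    proof -
      have "1 - (tanh x)\<^sup>2 = ((cosh x)\<^sup>2 - (sinh x)\<^sup>2) / (cosh x)\<^sup>2"
        using cosh_real_nonzero[of x] by (simp add: tanh_def power_divide diff_divide_distrib)
      then show ?thesis by (simp add: hyperbolic_pythagoras)
    qed
    ultimately show "((1 - (tanh x)\<^sup>2) * x - tanh x * 1) / (x * x) \<le> 0"
      using x by (intro divide_nonpos_nonneg) auto
  qed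
  then show ?thesis
    using assms(2) by (rule_tac DERIV_nonpos_imp_nonincreasing[of v w "\<lambda>x. tanh x / x"]) auto
qed

lemma tanh_le_self: "tanh u \<le> u" if "u \<ge> 0" for u :: real
proof -
  have "0 - tanh 0 \<le> u - tanh u"
  proof (rule DERIV_nonneg_imp_nondecreasing[of 0 u "\<lambda>x. x - tanh x"])
    show "\<exists>y. ((\<lambda>x. x - tanh x) has_real_derivative y) (at z) \<and> 0 \<le> y" for z :: real
      by (intro exI[of _ "1 - (1 - (tanh z)\<^sup>2)"] conjI DERIV_diff DERIV_ident
          has_field_derivative_tanh[OF _ DERIV_ident, unfolded mult_1_right]) auto
  qed (use that in simp)
  then show ?thesis by simp
qed

text \<open>
  Half the derivative of the phase \<open>f_fun\<close> in \<open>t\<close>.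
\<close>
definition half_freq :: "real \<Rightarrow> nat \<Rightarrow> real" where
  "half_freq t n = arsinh (sqrt (pi * n / (2 * t)))"

lemma half_freq_pos: "t > 0 \<Longrightarrow> n \<ge> 1 \<Longrightarrow> half_freq t n > 0"
  by (simp add: half_freq_def)

lemma half_freq_nonneg: "t > 0 \<Longrightarrow> half_freq t n \<ge> 0"
  using half_freq_pos[of t n] by (cases "n = 0") (auto simp: half_freq_def intro: less_imp_le)

lemma half_freq_antimono: "0 < s \<Longrightarrow> s \<le> t \<Longrightarrow> half_freq t n \<le> half_freq s n"
  unfolding half_freq_def
  by (subst not_less[symmetric], subst arsinh_less_iff_real) (auto intro!: divide_left_mono simp: not_less)

lemma tanh_half_freq:
  assumes "t > 0"
  shows "(tanh (half_freq t n))\<^sup>2 = pi * n / (2 * t + pi * n)"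
  using assms by (simp add: half_freq_def tanh_def cosh_arsinh_real power_divide field_simps)

text \<open>
  As \<open>u \<ge> tanh u\<close>, this follows from the closed form of \<open>tanh\<^sup>2 u\<close>, which is at least
  \<open>n/2t\<close> as long as \<open>n \<le> 2t (\<pi> - 1) / \<pi>\<close>; the factor \<open>4/3\<close> comes from \<open>\<pi> > 3\<close>.
\<close>
lemma half_freq_ge:
  assumes t: "t > 0" and n: "real n \<le> 4/3 * t"
  shows "sqrt (n / (2 * t)) \<le> half_freq t n"
proof -
  have "n / (2 * t) \<le> pi * n / (2 * t + pi * n)"
  proof -
    have "pi * real n \<le> pi * (4/3 * t)" using n by (intro mult_left_mono) auto
    also have "pi * (4/3 * t) = 4/3 * (pi * t)" by simp
    moreover have "3 * t \<le> pi * t" using pi_gt3 t by (intro mult_right_mono) auto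
    ultimately have "2 * t + pi * n \<le> 2 * (pi * t)" by linarith
    then have "2 * t + pi * n \<le> 2 * t * pi" by (simp only: ac_simps)
    then have "real n * (2 * t + pi * n) \<le> real n * (2 * t * pi)"
      by (intro mult_left_mono) auto
    then show ?thesis using t by (simp add: divide_simps add_pos_nonneg) (simp add: algebra_simps)
  qed
  also have "\<dots> = (tanh (half_freq t n))\<^sup>2" using t by (simp add: tanh_half_freq)
  finally have "sqrt (n / (2*t)) \<le> tanh (half_freq t n)"
    using t half_freq_nonneg[of t n] by (intro real_le_lsqrt) auto
  also have "\<dots> \<le> half_freq t n" using t half_freq_nonneg[of t n] by (intro tanh_le_self)
  finally show ?thesis .
qed

text \<open>
  The contributions of the inner derivatives of the two summands of \<open>f_fun\<close> are \<open>- r / sqrt (r\<^sup>2 + 1)\<close>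
  and \<open>r / sqrt (r\<^sup>2 + 1)\<close> with \<open>r = sqrt (\<pi>n/2t)\<close>, and cancel.
\<close>
lemma f_fun_has_derivative:
  assumes t: "t > 0" and n: "n \<ge> 1"
  shows "((\<lambda>t. f_fun t n) has_real_derivative 2 * half_freq t n) (at t)"
proof -
  define c where "c = pi * real n"
  have c: "c > 0" using n by (simp add: c_def)
  define r where "r = sqrt (c / (2 * t))"
  have r: "r > 0" "r\<^sup>2 = c / (2 * t)" using c t by (auto simp: r_def)
  have "((\<lambda>t. c / (2 * t)) has_real_derivative - (c / (2 * t\<^sup>2))) (at t)"
    using t by (auto intro!: derivative_eq_intros simp: power2_eq_square)
  from DERIV_real_sqrt[THEN DERIV_chain2, OF _ this] r(1)[unfolded r_def]
  have "((\<lambda>t. sqrt (c / (2 * t))) has_real_derivative - (c / (2 * t\<^sup>2)) / (2 * r)) (at t)"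
    by (simp add: r_def field_simps)
  from DERIV_chain2[OF arsinh_real_has_field_derivative this]
  have 1: "((\<lambda>t. arsinh (sqrt (c / (2 * t)))) has_real_derivative
      1 / sqrt (r\<^sup>2 + 1) * (- (c / (2 * t\<^sup>2)) / (2 * r))) (at t)"
    unfolding r_def[symmetric] .
  have 2: "((\<lambda>t. sqrt (c\<^sup>2 + 2 * c * t)) has_real_derivative 2 * c / (2 * sqrt (c\<^sup>2 + 2 * c * t))) (at t)"
  proof -
    have "c\<^sup>2 + 2 * c * t > 0" using c t by (simp add: add_pos_pos)
    then show ?thesis using t by (auto intro!: derivative_eq_intros simp: field_simps)
  qed
  have "((\<lambda>t. 2 * t * arsinh (sqrt (c / (2 * t))) + sqrt (c\<^sup>2 + 2 * c * t) - pi / 4) has_real_derivative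
      2 * arsinh r + 2 * t * (1 / sqrt (r\<^sup>2 + 1) * (- (c / (2 * t\<^sup>2)) / (2 * r)))
      + 2 * c / (2 * sqrt (c\<^sup>2 + 2 * c * t))) (at t)"
    by (rule derivative_eq_intros 1 2 refl | simp add: r_def)+
  also have "2 * t * (1 / sqrt (r\<^sup>2 + 1) * (- (c / (2 * t\<^sup>2)) / (2 * r))) = - r / sqrt (r\<^sup>2 + 1)"
  proof -
    have "c / (2 * t\<^sup>2) = r\<^sup>2 / t" unfolding r(2) by (simp add: power2_eq_square)
    then show ?thesis using r(1) t by (simp add: power2_eq_square)
  qed
  also have "2 * c / (2 * sqrt (c\<^sup>2 + 2 * c * t)) = r / sqrt (r\<^sup>2 + 1)"
  proof -
    have "c\<^sup>2 + 2 * c * t = (c / r)\<^sup>2 * (r\<^sup>2 + 1)"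
      using c t r(1) unfolding power_divide distrib_left by (simp add: r(2)) (simp add: power2_eq_square field_simps)
    then have "sqrt (c\<^sup>2 + 2 * c * t) = c / r * sqrt (r\<^sup>2 + 1)"
      using c r(1) by (simp add: real_sqrt_mult)
    then show ?thesis using c by simp
  qed
  finally show ?thesis by (simp add: half_freq_def r_def c_def f_fun_def mult.assoc)
qed

text \<open>
  In terms of \<open>u = half_freq t n\<close> one has \<open>t = \<pi>n / (2 sinh\<^sup>2 u)\<close>, and the algebraic factors of the
  amplitude combine to the fourth root of \<open>tanh\<^sup>2 u\<close>.
\<close>
lemma Sigma1_amplitude:
  assumes t: "t > 0" and n: "n \<ge> 1"
  shows "sqrt 2 * (t / (2 * pi)) powr (1/4) * e_fun t n =
           real n powr (1/4) * sqrt (tanh (half_freq t n)) / half_freq t n"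
proof -
  define y where "y = pi * real n / (2 * t)"
  have y: "y > 0" using t n by (simp add: y_def)
  have th: "(tanh (half_freq t n))\<^sup>2 = y / (1 + y)"
    using t n by (simp add: tanh_half_freq y_def field_simps)
  have "sqrt (tanh (half_freq t n)) = ((tanh (half_freq t n))\<^sup>2) powr (1/4)"
  proof -
    have "((tanh (half_freq t n))\<^sup>2) powr (1/4) = (tanh (half_freq t n) powr 2) powr (1/4)"
      using half_freq_pos[OF t n] by simp
    also have "\<dots> = sqrt (tanh (half_freq t n))"
      unfolding powr_powr using half_freq_pos[OF t n] by (simp add: powr_half_sqrt)
    finally show ?thesis ..
  qed
  then have s: "sqrt (tanh (half_freq t n)) = y powr (1/4) * (1 + y) powr (-1/4)"
    using y by (simp add: th powr_divide powr_minus_divide)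
  have "t / (2 * pi) = real n / (4 * y)" using t n by (simp add: y_def field_simps)
  then have "(t / (2 * pi)) powr (1/4) = real n powr (1/4) / (4 powr (1/4) * y powr (1/4))"
    using y n by (simp add: powr_divide powr_mult)
  moreover have "(4::real) powr (1/4) = sqrt 2"
  proof -
    have "(4::real) powr (1/4) = (2 powr 2) powr (1/4)" by simp
    also have "\<dots> = sqrt 2" unfolding powr_powr by (simp add: powr_half_sqrt)
    finally show ?thesis .
  qed
  moreover have "(2 * t / (pi * n)) powr (-1/2) = y powr (1/2)"
  proof -
    have "2 * t / (pi * n) = 1 / y" by (simp add: y_def)
    then show ?thesis using y by (simp add: powr_divide powr_minus_divide)
  qed
  moreover have "y powr (1/2) = y powr (1/4) * y powr (1/4)" by (simp flip: powr_add)
  ultimately show ?thesis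
    unfolding e_fun_def half_freq_def[symmetric] s unfolding y_def[symmetric] using y
    by (simp add: field_simps)
qed

section \<open>Sums of the divisor function against powers\<close>

lemma harm_le_ln: "n \<ge> 1 \<Longrightarrow> harm n \<le> 1 + ln (real n)"
proof (induction n rule: nat_induct_at_least)
  case base
  then show ?case by (simp add: harm_def)
next
  case (Suc n)
  have "harm (Suc n) - ln (Suc n) \<le> (harm n - ln n :: real)"
    using decseqD[OF decseq_harm_diff_ln, of "n - 1" n] Suc.hyps by simp
  then show ?case using Suc by simp
qed

lemma sum_inverse_le_ln:
  assumes "x \<ge> 1"
  shows "(\<Sum>k | 1 \<le> k \<and> real k \<le> x. 1 / real k) \<le> 1 + ln x"
proof -
  have "{k. 1 \<le> k \<and> real k \<le> x} = {1..nat \<lfloor>x\<rfloor>}"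
    using assms by (auto simp: le_nat_floor) linarith
  then have "(\<Sum>k | 1 \<le> k \<and> real k \<le> x. 1 / real k) = harm (nat \<lfloor>x\<rfloor>)"
    by (simp add: harm_def inverse_eq_divide)
  also have "\<dots> \<le> 1 + ln (real (nat \<lfloor>x\<rfloor>))"
    using assms by (intro harm_le_ln) (simp add: le_nat_floor)
  also have "\<dots> \<le> 1 + ln x" using assms by (simp add: ln_mono)
  finally show ?thesis .
qed

text \<open>
  Writing \<open>n = k m\<close> turns a sum weighted by the number of divisors into a double sum, in which the
  inner sum over \<open>m\<close> can be estimated without the divisor function.
\<close>
lemma num_divisors_sum:
  fixes F :: "nat \<Rightarrow> real"
  assumes S: "S \<subseteq> {1..N}"
  shows "(\<Sum>n\<in>S. real (num_divisors n) * F n) =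
    (\<Sum>k=1..N. \<Sum>m | 1 \<le> m \<and> k * m \<in> S. F (k * m))"
proof -
  have fS: "finite S" using S finite_subset by blast
  have fin: "finite {k. k dvd n}" if "n \<in> S" for n
    using S that by auto
  have fin2: "finite {m. 1 \<le> m \<and> k * m \<in> S}" if "k \<in> {1..N}" for k
  proof (rule finite_subset)
    show "{m. 1 \<le> m \<and> k * m \<in> S} \<subseteq> {..N}"
    proof clarify
      fix m assume m: "1 \<le> m" "k * m \<in> S"
      have "m \<le> k * m" using that by simp
      also have "\<dots> \<le> N" using m S by auto
      finally show "m \<le> N" .
    qed
  qed simp
  have "(\<Sum>n\<in>S. real (num_divisors n) * F n) = (\<Sum>n\<in>S. \<Sum>k | k dvd n. F n)"
    by (simp add: num_divisors_def)
  also have "\<dots> = (\<Sum>(n,k)\<in>(SIGMA n:S. {k. k dvd n}). F n)"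
    using fS fin by (subst sum.Sigma) auto
  also have "\<dots> = (\<Sum>(k,m)\<in>(SIGMA k:{1..N}. {m. 1 \<le> m \<and> k * m \<in> S}). F (k * m))"
  proof (rule sum.reindex_bij_witness[of _ "\<lambda>(k,m). (k * m, k)" "\<lambda>(n,k). (k, n div k)"])
    fix a assume "a \<in> (SIGMA n:S. {k. k dvd n})"
    then obtain k m where a: "a = (k * m, k)" "k * m \<in> S" by (auto elim!: dvdE)
    then have "1 \<le> k * m" "k * m \<le> N" using S by auto
    then have "1 \<le> k" "1 \<le> m" "k \<le> N"
      by (auto simp: Suc_le_eq intro: order_trans[OF _ \<open>k * m \<le> N\<close>])
    with a show "(case case a of (n, k) \<Rightarrow> (k, n div k) of (k, m) \<Rightarrow> (k * m, k)) = a"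
      "(case a of (n, k) \<Rightarrow> (k, n div k)) \<in> (SIGMA k:{1..N}. {m. 1 \<le> m \<and> k * m \<in> S})"
      "(case case a of (n, k) \<Rightarrow> (k, n div k) of (k, m) \<Rightarrow> F (k * m)) = (case a of (n, k) \<Rightarrow> F n)"
      by auto
  qed auto
  also have "\<dots> = (\<Sum>k=1..N. \<Sum>m | 1 \<le> m \<and> k * m \<in> S. F (k * m))"
    using fin2 by (subst sum.Sigma) auto
  finally show ?thesis .
qed

text \<open>
  With \<open>p = (m + 1)^(1/4)\<close> and \<open>q = m^(1/4)\<close>, this bounds \<open>(m + 1)^(-3/4)\<close> by the telescoping
  difference \<open>4 (p - q)\<close>, and likewise \<open>(m + 1)^(-5/4)\<close> by \<open>4 (1/q - 1/p)\<close>.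
\<close>
lemma quarter_power_gap:
  fixes p q :: real
  assumes "0 \<le> q" "q \<le> p" "p ^ 4 - q ^ 4 = 1"
  shows "1 \<le> 4 * p ^ 3 * (p - q)"
proof -
  have "1 = (p - q) * (p ^ 3 + p ^ 2 * q + p * q ^ 2 + q ^ 3)"
    unfolding assms(3)[symmetric] by (simp add: algebra_simps power_numeral_reduce)
  also have "\<dots> \<le> (p - q) * (p ^ 3 + p ^ 2 * p + p * p ^ 2 + p ^ 3)"
    using assms by (intro mult_left_mono add_mono power_mono) auto
  also have "\<dots> = 4 * p ^ 3 * (p - q)" by (simp add: algebra_simps power_numeral_reduce)
  finally show ?thesis .
qed

lemma powr_quarter_powers:
  assumes "x > (0::real)"
  shows "x powr (-3/4) = 1 / (x powr (1/4)) ^ 3" "x powr (-5/4) = 1 / (x powr (1/4)) ^ 5"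
    "x powr (-1/4) = 1 / x powr (1/4)" "(x powr (1/4)) ^ 4 = x"
  using assms by (simp_all add: powr_minus_divide powr_power)

lemma quarter_gap_nat:
  fixes m :: nat
  defines "p \<equiv> real (Suc m) powr (1/4)" and "q \<equiv> real m powr (1/4)"
  shows "0 \<le> q" "q \<le> p" "1 \<le> p" "1 \<le> 4 * p ^ 3 * (p - q)"
proof -
  show q: "0 \<le> q" "q \<le> p" by (auto simp: p_def q_def intro!: powr_mono2)
  show "1 \<le> p" unfolding p_def by (rule ge_one_powr_ge_zero) auto
  have "p ^ 4 = real (Suc m)" unfolding p_def by (rule powr_quarter_powers) simp
  moreover have "q ^ 4 = real m" unfolding q_def
    by (cases "m = 0") (auto intro: powr_quarter_powers)
  ultimately show "1 \<le> 4 * p ^ 3 * (p - q)"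
    by (intro quarter_power_gap q) simp
qed

lemma sum_powr_three_quarters:
  "(\<Sum>m=1..K. real m powr (-3/4)) \<le> 4 * real K powr (1/4)"
proof (induction K)
  case (Suc K)
  define p q where "p = real (Suc K) powr (1/4)" and "q = real K powr (1/4)"
  note pq = quarter_gap_nat[of K, folded p_def q_def]
  have "real (Suc K) powr (-3/4) = 1 / p ^ 3"
    unfolding p_def by (rule powr_quarter_powers) simp
  also have "\<dots> \<le> 4 * (p - q)" using pq by (simp add: field_simps)
  finally show ?case using Suc.IH by (simp add: p_def q_def del: of_nat_Suc)
qed simp

lemma sum_powr_five_quarters:
  assumes "1 \<le> k"
  shows "(\<Sum>m=k..K. real m powr (-5/4)) \<le> 5 * real k powr (-1/4)"
proof -
  have "(\<Sum>m=k..K. real m powr (-5/4)) \<le> 5 * real k powr (-1/4) - 4 * real K powr (-1/4)" if "k \<le> K"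
    using that
  proof (induction K rule: dec_induct)
    case base
    have "real k powr (-5/4) \<le> real k powr (-1/4)" using assms by (intro powr_mono) auto
    then show ?case by simp
  next
    case (step K)
    define p q where "p = real (Suc K) powr (1/4)" and "q = real K powr (1/4)"
    note pq = quarter_gap_nat[of K, folded p_def q_def]
    have q: "q > 0" using step assms by (simp add: q_def)
    have "1 / p ^ 5 \<le> 4 * (p - q) / p ^ 2"
      using pq by (simp add: field_simps power_numeral_reduce)
    also have "\<dots> \<le> 4 * (p - q) / (p * q)"
      using pq q by (intro divide_left_mono) (auto simp: power2_eq_square intro!: mult_left_mono)
    also have "\<dots> = 4 * (1 / q) - 4 * (1 / p)" using pq q by (simp add: field_simps)
    finally have "1 / p ^ 5 \<le> 4 * (1 / q) - 4 * (1 / p)" .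
    moreover have "real (Suc K) powr (-5/4) = 1 / p ^ 5" "real (Suc K) powr (-1/4) = 1 / p"
      unfolding p_def by (rule powr_quarter_powers; simp)+
    moreover have "real K powr (-1/4) = 1 / q"
      unfolding q_def using step assms by (intro powr_quarter_powers) simp
    ultimately show ?case using step by (simp del: of_nat_Suc)
  qed
  moreover have "0 \<le> real K powr (-1/4)" by simp
  ultimately show ?thesis by (cases "k \<le> K") (auto intro: order_trans)
qed

text \<open>
  For each divisor \<open>k\<close> the sum over the cofactors \<open>m \<le> M/k\<close> is at most \<open>4 M^(1/4) / k\<close>, and the
  remaining harmonic sum contributes the logarithm.
\<close>
lemma divisor_sum_head:
  assumes M: "M \<ge> 1"
  shows "(\<Sum>n | 1 \<le> n \<and> real n \<le> M. real (num_divisors n) * real n powr (-3/4)) \<le> 4 * M powr (1/4) * (1 + ln M)"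
proof -
  define K where "K = nat \<lfloor>M\<rfloor>"
  have K: "real n \<le> M \<longleftrightarrow> n \<le> K" for n using M unfolding K_def by (auto simp: le_nat_floor) linarith
  have "(\<Sum>n | 1 \<le> n \<and> real n \<le> M. real (num_divisors n) * real n powr (-3/4))
    = (\<Sum>k=1..K. \<Sum>m | 1 \<le> m \<and> k * m \<in> {n. 1 \<le> n \<and> real n \<le> M}. real (k * m) powr (-3/4))"
    by (rule num_divisors_sum) (auto simp: K)
  also have "\<dots> \<le> (\<Sum>k=1..K. 4 * M powr (1/4) * (1 / k))"
  proof (rule sum_mono)
    fix k assume k: "k \<in> {1..K}"
    have "{m. 1 \<le> m \<and> k * m \<in> {n. 1 \<le> n \<and> real n \<le> M}} = {1..nat \<lfloor>M / k\<rfloor>}"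
    proof -
      have "real (k * m) \<le> M \<longleftrightarrow> m \<le> nat \<lfloor>M / k\<rfloor>" if "m \<ge> 1" for m
      proof -
        have "real (k * m) \<le> M \<longleftrightarrow> real m \<le> M / k" using k by (simp add: field_simps)
        also have "\<dots> \<longleftrightarrow> m \<le> nat \<lfloor>M / k\<rfloor>" using that M
          by (auto simp: le_nat_floor) linarith
        finally show ?thesis .
      qed
      then show ?thesis using k by auto
    qed
    then have "(\<Sum>m | 1 \<le> m \<and> k * m \<in> {n. 1 \<le> n \<and> real n \<le> M}. real (k * m) powr (-3/4))
       = real k powr (-3/4) * (\<Sum>m=1..nat \<lfloor>M / k\<rfloor>. real m powr (-3/4))"
      by (simp add: powr_mult sum_distrib_left)
    also have "\<dots> \<le> real k powr (-3/4) * (4 * real (nat \<lfloor>M / k\<rfloor>) powr (1/4))"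
      by (intro mult_left_mono sum_powr_three_quarters) auto
    also have "\<dots> \<le> real k powr (-3/4) * (4 * (M / k) powr (1/4))"
      using M by (intro mult_left_mono powr_mono2) auto
    also have "\<dots> = 4 * M powr (1/4) * (real k powr (-3/4) * real k powr (-1/4))"
      using M k by (simp add: powr_divide powr_minus_divide)
    also have "real k powr (-3/4) * real k powr (-1/4) = 1 / k"
      unfolding powr_add[symmetric] using k by (simp add: powr_minus_divide)
    finally show "(\<Sum>m | 1 \<le> m \<and> k * m \<in> {n. 1 \<le> n \<and> real n \<le> M}. real (k * m) powr (-3/4))
       \<le> 4 * M powr (1/4) * (1 / k)" .
  qed
  also have "\<dots> = 4 * M powr (1/4) * (\<Sum>k | 1 \<le> k \<and> real k \<le> M. 1 / k)"
    unfolding sum_distrib_left by (rule sum.cong) (auto simp: K)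
  also have "\<dots> \<le> 4 * M powr (1/4) * (1 + ln M)"
    using M by (intro mult_left_mono sum_inverse_le_ln) auto
  finally show ?thesis .
qed

text \<open>
  The cofactors of \<open>k\<close> now satisfy \<open>m > M/k\<close>. Starting their sum at the least integer above \<open>M/k\<close>
  keeps the bound \<open>5 M^(-1/4) / k\<close> valid for \<open>k > M\<close> as well, so no case distinction arises.
\<close>
lemma divisor_sum_tail:
  fixes N :: nat
  assumes M: "M > 0" and N: "N \<ge> 1"
  shows "(\<Sum>n | n \<le> N \<and> M < real n. real (num_divisors n) * real n powr (-5/4)) \<le> 5 * M powr (-1/4) * (1 + ln N)"
proof -
  let ?S = "{n. n \<le> N \<and> M < real n}"
  have "(\<Sum>n\<in>?S. real (num_divisors n) * real n powr (-5/4))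
    = (\<Sum>k=1..N. \<Sum>m | 1 \<le> m \<and> k * m \<in> ?S. real (k * m) powr (-5/4))"
    by (rule num_divisors_sum) (use M in \<open>auto simp: Suc_le_eq intro!: Nat.gr0I\<close>)
  also have "\<dots> \<le> (\<Sum>k=1..N. 5 * M powr (-1/4) * (1 / k))"
  proof (rule sum_mono)
    fix k assume k: "k \<in> {1..N}"
    define j where "j = nat \<lfloor>M / k\<rfloor> + 1"
    have j: "M / k < real j" using M k unfolding j_def by (simp add: nat_less_real_le) linarith
    have "(\<Sum>m | 1 \<le> m \<and> k * m \<in> ?S. real (k * m) powr (-5/4)) \<le> (\<Sum>m=j..N. real (k * m) powr (-5/4))"
    proof (rule sum_mono2)
      show "{m. 1 \<le> m \<and> k * m \<in> ?S} \<subseteq> {j..N}"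
      proof clarify
        fix m assume m: "1 \<le> m" "k * m \<le> N" "M < real (k * m)"
        have "m \<le> k * m" using k by simp
        then have "m \<le> N" using m(2) by (rule order_trans)
        moreover have "M / k < real m" using m k by (simp add: field_simps)
        then have "j \<le> m" using M k unfolding j_def by (simp add: Suc_le_eq nat_less_iff floor_less_iff)
        ultimately show "m \<in> {j..N}" using m by simp
      qed
    qed auto
    also have "\<dots> = real k powr (-5/4) * (\<Sum>m=j..N. real m powr (-5/4))"
      by (simp add: powr_mult sum_distrib_left)
    also have "\<dots> \<le> real k powr (-5/4) * (5 * real j powr (-1/4))"
      by (intro mult_left_mono sum_powr_five_quarters) (auto simp: j_def)
    also have "\<dots> \<le> real k powr (-5/4) * (5 * (M / k) powr (-1/4))"
      using M k j by (intro mult_left_mono powr_mono2') auto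
    also have "\<dots> = 5 * M powr (-1/4) * (real k powr (-5/4) * real k powr (1/4))"
      using M k by (simp add: powr_divide powr_minus_divide)
    also have "real k powr (-5/4) * real k powr (1/4) = 1 / k"
      unfolding powr_add[symmetric] using k by (simp add: powr_minus_divide)
    finally show "(\<Sum>m | 1 \<le> m \<and> k * m \<in> ?S. real (k * m) powr (-5/4)) \<le> 5 * M powr (-1/4) * (1 / k)" .
  qed
  also have "\<dots> = 5 * M powr (-1/4) * (\<Sum>k | 1 \<le> k \<and> real k \<le> real N. 1 / k)"
    unfolding sum_distrib_left by (rule sum.cong) auto
  also have "\<dots> \<le> 5 * M powr (-1/4) * (1 + ln N)"
    using N by (intro mult_left_mono sum_inverse_le_ln) auto
  finally show ?thesis .
qed

section \<open>The mean of the first sum\<close>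

definition Sigma1_term :: "nat \<Rightarrow> real \<Rightarrow> real" where
  "Sigma1_term n t = sqrt 2 * (t / (2 * pi)) powr (1/4) *
     ((- 1) ^ n * (num_divisors n / n powr (3/4)) * e_fun t n * cos (f_fun t n))"

lemma Sigma1_eq_sum: "Sigma1 t N = (\<Sum>n=1..N. Sigma1_term n t)"
  by (simp add: Sigma1_def Sigma1_term_def sum_distrib_left)

text \<open>
  The amplitude of a term of \<open>\<Sigma>\<^sub>1\<close> divided by \<open>2 half_freq\<close>, up to factors independent of \<open>t\<close>. It is
  written as a product of three monotone factors.
\<close>
definition Sigma1_weight :: "real \<Rightarrow> nat \<Rightarrow> real" where
  "Sigma1_weight t n = sqrt (tanh (half_freq t n) / half_freq t n) / (2 * half_freq t n * sqrt (half_freq t n))"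

lemma Sigma1_term_eq:
  assumes t: "t > 0" and n: "n \<ge> 1"
  shows "Sigma1_term n t = (- 1) ^ n * num_divisors n * real n powr (-1/2) *
     (Sigma1_weight t n * (2 * half_freq t n * cos (f_fun t n)))"
proof -
  have u: "half_freq t n > 0" using half_freq_pos[OF t n] .
  have w: "Sigma1_weight t n * (2 * half_freq t n) = sqrt (tanh (half_freq t n)) / half_freq t n"
    using u by (simp add: Sigma1_weight_def real_sqrt_divide)
  have q: "real n powr (1/4) / real n powr (3/4) = real n powr (-1/2)"
    unfolding powr_diff[symmetric] by simp
  have "Sigma1_term n t = (- 1) ^ n * num_divisors n / real n powr (3/4) *
     (sqrt 2 * (t / (2 * pi)) powr (1/4) * e_fun t n) * cos (f_fun t n)"
    by (simp add: Sigma1_term_def)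
  also have "\<dots> = (- 1) ^ n * num_divisors n * (real n powr (1/4) / real n powr (3/4)) *
     ((sqrt (tanh (half_freq t n)) / half_freq t n) * cos (f_fun t n))"
    unfolding Sigma1_amplitude[OF t n] by simp
  finally show ?thesis unfolding q w[symmetric] by (simp only: mult.assoc)
qed

lemma Sigma1_weight_mono:
  assumes "0 < s" "s \<le> t" "n \<ge> 1"
  shows "Sigma1_weight s n \<le> Sigma1_weight t n"
proof -
  have u: "0 < half_freq t n" "half_freq t n \<le> half_freq s n"
    using assms by (auto intro: half_freq_pos half_freq_antimono)
  have "sqrt (tanh (half_freq s n) / half_freq s n) \<le> sqrt (tanh (half_freq t n) / half_freq t n)"
    using tanh_div_antimono[OF u] by simp
  then show ?thesis unfolding Sigma1_weight_def
    using u by (intro frac_le mult_mono mult_pos_pos real_sqrt_ge_zero divide_nonneg_nonneg) auto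
qed

lemma inverse_sqrt_half_freq_le:
  assumes t: "0 < t" "t \<le> b" and n: "n \<ge> 1" "real n \<le> 4/3 * t"
  shows "1 / sqrt (half_freq t n) \<le> (2 * b) powr (1/4) * real n powr (-1/4)"
proof -
  have "1 / sqrt (half_freq t n) \<le> 1 / sqrt (sqrt (n / (2 * t)))"
    using t n half_freq_ge[of t n] half_freq_pos[of t n] by (intro divide_left_mono) auto
  also have "sqrt (sqrt (n / (2 * t))) = (n / (2 * t)) powr (1/4)"
    using t n by (simp add: powr_powr flip: powr_half_sqrt)
  also have "1 / (n / (2 * t)) powr (1/4) = (2 * t) powr (1/4) * real n powr (-1/4)"
    using t n by (simp add: powr_divide powr_minus_divide)
  also have "\<dots> \<le> (2 * b) powr (1/4) * real n powr (-1/4)"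
    using t by (intro mult_right_mono powr_mono2) auto
  finally show ?thesis .
qed

lemma Sigma1_term_bound:
  assumes t: "0 < t" "t \<le> b" and n: "n \<ge> 1" "real n \<le> 4/3 * t"
  shows "\<bar>Sigma1_term n t\<bar> \<le> (2 * b) powr (1/4) * (num_divisors n * real n powr (-3/4))"
proof -
  have u: "half_freq t n > 0" using half_freq_pos t n by blast
  have "tanh (half_freq t n) / half_freq t n \<le> 1" using u tanh_le_self[of "half_freq t n"] by simp
  then have "sqrt (tanh (half_freq t n) / half_freq t n) / sqrt (half_freq t n) \<le> 1 / sqrt (half_freq t n)"
    using u by (intro divide_right_mono) auto
  also note inverse_sqrt_half_freq_le[OF t n]
  finally have w: "Sigma1_weight t n * (2 * half_freq t n) \<le> (2 * b) powr (1/4) * real n powr (-1/4)"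
    using u by (simp add: Sigma1_weight_def)
  have w0: "Sigma1_weight t n \<ge> 0" using u by (simp add: Sigma1_weight_def)
  have "\<bar>Sigma1_term n t\<bar> = num_divisors n * real n powr (-1/2) *
     (Sigma1_weight t n * (2 * half_freq t n) * \<bar>cos (f_fun t n)\<bar>)"
    using u w0 t n by (simp add: Sigma1_term_eq abs_mult power_abs)
  also have "\<dots> \<le> num_divisors n * real n powr (-1/2) * ((2 * b) powr (1/4) * real n powr (-1/4) * 1)"
    using u w0 by (intro mult_left_mono mult_mono[OF w]) auto
  also have "\<dots> = (2 * b) powr (1/4) * (num_divisors n * (real n powr (-1/2) * real n powr (-1/4)))"
    by simp
  also have "real n powr (-1/2) * real n powr (-1/4) = real n powr (-3/4)"
    unfolding powr_add[symmetric] by simp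
  finally show ?thesis .
qed

text \<open>
  The first bound is the length of the interval times a bound for the integrand, and is the better
  one for small \<open>n\<close>; the second one is the gain from oscillation.
\<close>
lemma Sigma1_term_integral:
  assumes a: "0 < a" "a \<le> b" and n: "n \<ge> 1" "real n \<le> 4/3 * a"
  obtains I where "(Sigma1_term n has_integral I) {a..b}"
    "\<bar>I\<bar> \<le> (b - a) * (2 * b) powr (1/4) * (num_divisors n * real n powr (-3/4))"
    "\<bar>I\<bar> \<le> (2 * b) powr (3/4) * (num_divisors n * real n powr (-5/4))"
proof -
  let ?c = "(- 1) ^ n * real (num_divisors n) * real n powr (-1/2)"
  let ?W = "\<lambda>t. Sigma1_weight t n"
  have ub: "half_freq b n > 0" using half_freq_pos a n by simp
  have W0: "?W t \<ge> 0" if "t \<ge> a" for t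
    using that a n half_freq_pos[of t n] by (simp add: Sigma1_weight_def)
  obtain J where J: "((\<lambda>t. ?W t * (2 * half_freq t n * cos (f_fun t n))) has_integral J) {a..b}"
    "\<bar>J\<bar> \<le> \<bar>?W a\<bar> + \<bar>?W b\<bar> + (?W b - ?W a)"
  proof (rule cos_phase_integral[OF a(2), of ?W "\<lambda>t. f_fun t n" "\<lambda>t. 2 * half_freq t n"])
    show "?W x \<le> ?W y" if "a \<le> x" "x \<le> y" "y \<le> b" for x y
      using that a n by (intro Sigma1_weight_mono) auto
    show "((\<lambda>t. f_fun t n) has_real_derivative 2 * half_freq x n) (at x)" if "a \<le> x" "x \<le> b" for x
      using that a n by (intro f_fun_has_derivative) auto
  qed blast
  have I: "(Sigma1_term n has_integral ?c * J) {a..b}"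
    using has_integral_mult_right[OF J(1), of ?c]
    by (rule has_integral_eq[rotated]) (use a n in \<open>simp add: Sigma1_term_eq\<close>)
  have "\<bar>J\<bar> \<le> 2 * ?W b" using J(2) W0[of a] W0[of b] a by simp
  also have "2 * ?W b \<le> (1 / sqrt (half_freq b n)) ^ 3"
  proof -
    have "tanh (half_freq b n) / half_freq b n \<le> 1" using ub tanh_le_self[of "half_freq b n"] by simp
    then have "2 * ?W b \<le> 2 * (1 / (2 * half_freq b n * sqrt (half_freq b n)))"
      unfolding Sigma1_weight_def using ub by (intro mult_left_mono divide_right_mono) auto
    also have "\<dots> = (1 / sqrt (half_freq b n)) ^ 3"
      using ub by (simp add: power3_eq_cube)
    finally show ?thesis .
  qed
  also have "\<dots> \<le> ((2 * b) powr (1/4) * real n powr (-1/4)) ^ 3"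
    using a n ub by (intro power_mono inverse_sqrt_half_freq_le) auto
  also have "\<dots> = (2 * b) powr (3/4) * real n powr (-3/4)"
    using a n by (simp add: power_mult_distrib powr_power)
  finally have Jb: "\<bar>J\<bar> \<le> (2 * b) powr (3/4) * real n powr (-3/4)" .
  have "\<bar>?c * J\<bar> = num_divisors n * real n powr (-1/2) * \<bar>J\<bar>"
    by (simp add: abs_mult power_abs)
  also have "\<dots> \<le> num_divisors n * real n powr (-1/2) * ((2 * b) powr (3/4) * real n powr (-3/4))"
    using Jb by (intro mult_left_mono) auto
  also have "\<dots> = (2 * b) powr (3/4) * (num_divisors n * (real n powr (-1/2) * real n powr (-3/4)))"
    by simp
  also have "real n powr (-1/2) * real n powr (-3/4) = real n powr (-5/4)"
    unfolding powr_add[symmetric] by simp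
  finally have 2: "\<bar>?c * J\<bar> \<le> (2 * b) powr (3/4) * (num_divisors n * real n powr (-5/4))" .
  have "\<bar>?c * J\<bar> \<le> (2 * b) powr (1/4) * (num_divisors n * real n powr (-3/4)) * (b - a)"
    using has_integral_bound_real[OF _ finite.emptyI I,
        of "(2 * b) powr (1/4) * (num_divisors n * real n powr (-3/4))"]
      Sigma1_term_bound[of _ b n] a n by auto
  with I 2 show ?thesis using that[of "?c * J"] by (simp add: mult_ac)
qed

text \<open>
  The terms with \<open>n \<le> M\<close> are estimated by size and the others by oscillation. The two bounds of
  \<open>Sigma1_term_integral\<close> balance at \<open>n\<close> of order \<open>b / (b - a)\<^sup>2\<close>.
\<close>
lemma Sigma1_integral:
  fixes N :: nat and a b M :: real
  assumes a: "0 < a" "a \<le> b" and N: "real N \<le> 4/3 * a" and M: "1 \<le> M" "M \<le> N"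
  obtains I where "((\<lambda>t. Sigma1 t N) has_integral I) {a..b}"
    "\<bar>I\<bar> \<le> (b - a) * (2 * b) powr (1/4) * (4 * M powr (1/4) * (1 + ln M))
        + (2 * b) powr (3/4) * (5 * M powr (-1/4) * (1 + ln N))"
proof -
  have "\<forall>n\<in>{1..N}. \<exists>I. (Sigma1_term n has_integral I) {a..b} \<and>
    \<bar>I\<bar> \<le> (b - a) * (2 * b) powr (1/4) * (num_divisors n * real n powr (-3/4)) \<and>
    \<bar>I\<bar> \<le> (2 * b) powr (3/4) * (num_divisors n * real n powr (-5/4))"
  proof
    fix n assume n: "n \<in> {1..N}"
    then have "1 \<le> n" "real n \<le> 4/3 * a" using N by auto
    from Sigma1_term_integral[OF a this] show "\<exists>I. (Sigma1_term n has_integral I) {a..b} \<and>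
      \<bar>I\<bar> \<le> (b - a) * (2 * b) powr (1/4) * (num_divisors n * real n powr (-3/4)) \<and>
      \<bar>I\<bar> \<le> (2 * b) powr (3/4) * (num_divisors n * real n powr (-5/4))" by metis
  qed
  then obtain I where I: "\<And>n. n \<in> {1..N} \<Longrightarrow> (Sigma1_term n has_integral I n) {a..b}"
    "\<And>n. n \<in> {1..N} \<Longrightarrow> \<bar>I n\<bar> \<le> (b - a) * (2 * b) powr (1/4) * (num_divisors n * real n powr (-3/4))"
    "\<And>n. n \<in> {1..N} \<Longrightarrow> \<bar>I n\<bar> \<le> (2 * b) powr (3/4) * (num_divisors n * real n powr (-5/4))"
    by (metis (no_types, lifting) bchoice)
  let ?S = "{n. 1 \<le> n \<and> real n \<le> M}" and ?R = "{n. n \<le> N \<and> M < real n}"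
  have SR: "{1..N} = ?S \<union> ?R" "?S \<inter> ?R = {}" "?S \<subseteq> {1..N}" "?R \<subseteq> {1..N}" "finite ?S" "finite ?R"
    using M by (auto intro: finite_subset[of _ "{1..N}"])
  have "\<bar>\<Sum>n=1..N. I n\<bar> \<le> (\<Sum>n=1..N. \<bar>I n\<bar>)" by (rule sum_abs)
  also have "\<dots> = (\<Sum>n\<in>?S. \<bar>I n\<bar>) + (\<Sum>n\<in>?R. \<bar>I n\<bar>)"
    unfolding SR(1) using SR by (intro sum.union_disjoint) auto
  also have "\<dots> \<le> (\<Sum>n\<in>?S. (b - a) * (2 * b) powr (1/4) * (num_divisors n * real n powr (-3/4)))
      + (\<Sum>n\<in>?R. (2 * b) powr (3/4) * (num_divisors n * real n powr (-5/4)))"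
    using SR by (intro add_mono sum_mono I) auto
  also have "\<dots> = (b - a) * (2 * b) powr (1/4) * (\<Sum>n\<in>?S. num_divisors n * real n powr (-3/4))
      + (2 * b) powr (3/4) * (\<Sum>n\<in>?R. num_divisors n * real n powr (-5/4))"
    by (simp only: sum_distrib_left)
  also have "\<dots> \<le> (b - a) * (2 * b) powr (1/4) * (4 * M powr (1/4) * (1 + ln M))
        + (2 * b) powr (3/4) * (5 * M powr (-1/4) * (1 + ln N))"
    using a M by (intro add_mono mult_left_mono divisor_sum_head divisor_sum_tail) auto
  finally have "\<bar>\<Sum>n=1..N. I n\<bar> \<le> \<dots>" .
  moreover have "((\<lambda>t. Sigma1 t N) has_integral (\<Sum>n=1..N. I n)) {a..b}"
    unfolding Sigma1_eq_sum by (intro has_integral_sum I) auto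
  ultimately show ?thesis using that by blast
qed

section \<open>The mean of the second sum\<close>

text \<open>
  The time at which the \<open>n\<close>-th term enters \<open>\<Sigma>\<^sub>2\<close>. For fixed \<open>N\<close> the range of summation grows with \<open>t\<close>,
  so on an interval each term lives on a final segment, and the oscillation estimate still applies.
\<close>
definition cut_time :: "nat \<Rightarrow> nat \<Rightarrow> real" where
  "cut_time N n = 2 * pi * (n + sqrt n * sqrt (N + 1/2))"

lemma le_Z_cut_iff:
  assumes t: "t > 0"
  shows "real n \<le> Z_cut t N \<longleftrightarrow> cut_time N n \<le> t"
proof -
  define A where "A = real N + 1/2"
  have A: "A > 0" by (simp add: A_def)
  define D where "D = sqrt (A + 2 * t / pi) - sqrt A"
  have D: "D \<ge> 0" using t by (simp add: D_def)
  have "real n \<le> Z_cut t N \<longleftrightarrow> (2 * sqrt n)\<^sup>2 \<le> D\<^sup>2"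
    by (simp add: Z_cut_def D_def A_def power_mult_distrib mult.commute)
  also have "\<dots> \<longleftrightarrow> 2 * sqrt n \<le> D"
    using D by (intro power_mono_iff) auto
  also have "\<dots> \<longleftrightarrow> 2 * sqrt n + sqrt A \<le> sqrt (A + 2 * t / pi)"
    by (auto simp: D_def)
  also have "\<dots> \<longleftrightarrow> (2 * sqrt n + sqrt A)\<^sup>2 \<le> (sqrt (A + 2 * t / pi))\<^sup>2"
    using A t by (intro power_mono_iff[symmetric]) auto
  also have "\<dots> \<longleftrightarrow> 4 * n + 4 * (sqrt n * sqrt A) \<le> 2 * t / pi"
    using A t by (simp add: power2_sum power_mult_distrib mult.assoc)
  also have "\<dots> \<longleftrightarrow> cut_time N n \<le> t"
    unfolding cut_time_def A_def[symmetric] by (simp add: pos_le_divide_eq algebra_simps) linarith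
  finally show ?thesis .
qed

lemma cut_time_ge: "real n \<le> cut_time N n"
proof -
  have "1 * real n \<le> 2 * pi * (n + sqrt n * sqrt (N + 1/2))"
    using pi_gt3 by (intro mult_mono) auto
  then show ?thesis by (simp add: cut_time_def)
qed

text \<open>
  Already \<open>t \<ge> 2\<pi> sqrt (n N)\<close> with \<open>N \<ge> 0.9 t\<close> forces \<open>t / (2\<pi>n) \<ge> 1.8 \<pi>\<close>, which exceeds \<open>e\<close>.
\<close>
lemma ln_ge_1_beyond_cut_time:
  assumes t: "t > 0" "cut_time N n \<le> t" and n: "n \<ge> 1" and N: "0.9 * t \<le> real N"
  shows "1 \<le> ln (t / (2 * pi * n))"
proof -
  have "2 * pi * (sqrt n * sqrt (0.9 * t)) \<le> 2 * pi * (n + sqrt n * sqrt (N + 1/2))"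
    using N by (intro mult_left_mono add_increasing) auto
  also have "\<dots> \<le> t" using t(2) by (simp add: cut_time_def)
  finally have "(2 * pi * (sqrt n * sqrt (0.9 * t)))\<^sup>2 \<le> t\<^sup>2"
    using t by (intro power_mono) auto
  then have "t * (3.6 * pi\<^sup>2 * n) \<le> t * t"
    using t by (simp add: power_mult_distrib power2_eq_square[of t] mult_ac)
  then have "3.6 * pi\<^sup>2 * n \<le> t" using t(1) by (simp only: mult_le_cancel_left_pos)
  then have "1.8 * pi \<le> t / (2 * pi * n)" using n by (simp add: field_simps power2_eq_square)
  moreover have "exp 1 \<le> 1.8 * pi" using e_less_272 pi_gt3 by simp
  ultimately have "exp 1 \<le> t / (2 * pi * n)" by simp
  then show ?thesis using t n by (subst ln_ge_iff) auto
qed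

lemma g_fun_has_derivative:
  assumes t: "t > 0" and n: "n \<ge> 1"
  shows "((\<lambda>t. g_fun t n) has_real_derivative ln (t / (2 * pi * n))) (at t)"
proof -
  define c where "c = 2 * pi * real n"
  have c: "c > 0" using n by (simp add: c_def)
  have "((\<lambda>t. ln (t / c)) has_real_derivative 1 / (t / c) * (1 / c)) (at t)"
    using t c by (intro DERIV_chain2[OF DERIV_ln_divide] DERIV_cdivide DERIV_ident) auto
  then have "((\<lambda>t. ln (t / c)) has_real_derivative 1 / t) (at t)" using c by simp
  from DERIV_add[OF DERIV_diff[OF DERIV_mult[OF DERIV_ident this] DERIV_ident] DERIV_const]
  show ?thesis using t by (simp add: g_fun_def c_def)
qed

definition Sigma2_term :: "nat \<Rightarrow> real \<Rightarrow> real" where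
  "Sigma2_term n t = - 2 * (num_divisors n / n powr (1/2) * inverse (ln (t / (2 * pi * n))) * cos (g_fun t n))"

lemma Sigma2_eq_sum:
  assumes t: "0 < t" "t \<le> real K"
  shows "Sigma2 t N = (\<Sum>n=1..K. if cut_time N n \<le> t then Sigma2_term n t else 0)"
proof -
  have "{n. 1 \<le> n \<and> real n \<le> Z_cut t N} = {n\<in>{1..K}. cut_time N n \<le> t}"
  proof (intro set_eqI)
    fix n
    have "n \<le> K" if "cut_time N n \<le> t"
      using order_trans[OF cut_time_ge[of n N] order_trans[OF that t(2)]] by simp
    then show "n \<in> {n. 1 \<le> n \<and> real n \<le> Z_cut t N} \<longleftrightarrow> n \<in> {n\<in>{1..K}. cut_time N n \<le> t}"
      using le_Z_cut_iff[OF t(1)] by auto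
  qed
  then have "Sigma2 t N = (\<Sum>n | n \<in> {1..K} \<and> cut_time N n \<le> t. Sigma2_term n t)"
    unfolding Sigma2_def Sigma2_term_def sum_distrib_left by simp
  also have "\<dots> = (\<Sum>n=1..K. if cut_time N n \<le> t then Sigma2_term n t else 0)"
    by (rule sum.inter_filter) simp
  finally show ?thesis .
qed

text \<open>
  The phase derivative \<open>ln (t / 2\<pi>n)\<close> also occurs as a denominator of the amplitude, so the monotone
  factor is \<open>- 1 / ln\<^sup>2\<close>, of absolute value at most 1; its sign makes it increasing.
\<close>
lemma Sigma2_term_integral:
  assumes c: "0 < c" "c \<le> b" "cut_time N n \<le> c" and n: "n \<ge> 1" and N: "0.9 * b \<le> real N"
  obtains I where "(Sigma2_term n has_integral I) {c..b}"
    "\<bar>I\<bar> \<le> 4 * (num_divisors n * real n powr (-1/2))"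
proof -
  let ?l = "\<lambda>t. ln (t / (2 * pi * n))"
  let ?G = "\<lambda>t. - (1 / (?l t)\<^sup>2)"
  have l: "1 \<le> ?l t" if "c \<le> t" "t \<le> b" for t
    using that c n N by (intro ln_ge_1_beyond_cut_time[of t N]) auto
  obtain J where J: "((\<lambda>t. ?G t * (?l t * cos (g_fun t n))) has_integral J) {c..b}"
    "\<bar>J\<bar> \<le> \<bar>?G c\<bar> + \<bar>?G b\<bar> + (?G b - ?G c)"
  proof (rule cos_phase_integral[OF c(2), of ?G "\<lambda>t. g_fun t n" ?l])
    show "?G x \<le> ?G y" if xy: "c \<le> x" "x \<le> y" "y \<le> b" for x y
    proof -
      have "?l x \<le> ?l y"
        using xy c n by (intro ln_mono divide_right_mono divide_pos_pos) auto
      then have "1 / (?l y)\<^sup>2 \<le> 1 / (?l x)\<^sup>2"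
        using l[of x] xy by (intro divide_left_mono power_mono mult_pos_pos) auto
      then show ?thesis by simp
    qed
    show "((\<lambda>t. g_fun t n) has_real_derivative ?l x) (at x)" if "c \<le> x" "x \<le> b" for x
      using that c n by (intro g_fun_has_derivative) auto
  qed blast
  have "\<bar>J\<bar> \<le> 2 * (1 / (?l c)\<^sup>2)" using J(2) by simp
  also have "1 / (?l c)\<^sup>2 \<le> 1" using l[of c] c by simp
  finally have Jb: "\<bar>J\<bar> \<le> 2" by simp
  let ?k = "2 * (num_divisors n * real n powr (-1/2))"
  have "(Sigma2_term n has_integral ?k * J) {c..b}"
    using has_integral_mult_right[OF J(1), of ?k]
  proof (rule has_integral_eq[rotated])
    fix t assume "t \<in> {c..b}"
    then show "?k * (?G t * (?l t * cos (g_fun t n))) = Sigma2_term n t"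
      using l[of t] by (simp add: Sigma2_term_def powr_minus_divide power2_eq_square field_simps)
  qed
  moreover have "\<bar>?k * J\<bar> \<le> ?k * 2"
    unfolding abs_mult using Jb by (intro mult_mono) auto
  ultimately show ?thesis using that[of "?k * J"] by simp
qed

lemma Sigma2_integral:
  assumes a: "0 < a" "a \<le> b" and b: "1 \<le> b" and N: "0.9 * b \<le> real N"
  obtains I where "((\<lambda>t. Sigma2 t N) has_integral I) {a..b}"
    "\<bar>I\<bar> \<le> 32 * sqrt b * (1 + ln (2 * b))"
proof -
  define K where "K = nat \<lceil>b\<rceil>"
  have K: "b \<le> real K" "real K \<le> 2 * b" "1 \<le> K" using b unfolding K_def by linarith+
  let ?f = "\<lambda>n t. if cut_time N n \<le> t then Sigma2_term n t else 0"
  have "\<forall>n\<in>{1..K}. \<exists>I. (?f n has_integral I) {a..b} \<and>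
    \<bar>I\<bar> \<le> 4 * (num_divisors n * real n powr (-1/2))"
  proof
    fix n assume n: "n \<in> {1..K}"
    define c where "c = max a (cut_time N n)"
    show "\<exists>I. (?f n has_integral I) {a..b} \<and> \<bar>I\<bar> \<le> 4 * (num_divisors n * real n powr (-1/2))"
    proof (cases "c \<le> b")
      case True
      obtain I where I: "(Sigma2_term n has_integral I) {c..b}"
        "\<bar>I\<bar> \<le> 4 * (num_divisors n * real n powr (-1/2))"
        by (rule Sigma2_term_integral[of c b N n]) (use a True n N in \<open>auto simp: c_def\<close>)
      have "((\<lambda>t. if t \<in> {c..b} then Sigma2_term n t else 0) has_integral I) {a..b}"
        using I(1) by (subst has_integral_restrict) (auto simp: c_def)
      then have "(?f n has_integral I) {a..b}"
        by (rule has_integral_eq[rotated]) (auto simp: c_def)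
      with I(2) show ?thesis by blast
    next
      case False
      have "(?f n has_integral 0) {a..b}"
        by (rule has_integral_is_0) (use False a in \<open>auto simp: c_def\<close>)
      then show ?thesis by (intro exI[of _ 0]) auto
    qed
  qed
  then obtain I where I: "\<And>n. n \<in> {1..K} \<Longrightarrow> (?f n has_integral I n) {a..b}"
    "\<And>n. n \<in> {1..K} \<Longrightarrow> \<bar>I n\<bar> \<le> 4 * (num_divisors n * real n powr (-1/2))"
    by metis
  have "\<bar>\<Sum>n=1..K. I n\<bar> \<le> (\<Sum>n=1..K. \<bar>I n\<bar>)" by (rule sum_abs)
  also have "\<dots> \<le> (\<Sum>n=1..K. 4 * real K powr (1/4) * (num_divisors n * real n powr (-3/4)))"
  proof (rule sum_mono)
    fix n assume n: "n \<in> {1..K}"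
    have "real n powr (-1/2) = real n powr (1/4) * real n powr (-3/4)"
      unfolding powr_add[symmetric] by simp
    also have "\<dots> \<le> real K powr (1/4) * real n powr (-3/4)"
      using n by (intro mult_right_mono powr_mono2) auto
    finally have "4 * (num_divisors n * real n powr (-1/2))
      \<le> 4 * (num_divisors n * (real K powr (1/4) * real n powr (-3/4)))"
      by (intro mult_left_mono) auto
    with I(2)[OF n] show "\<bar>I n\<bar> \<le> 4 * real K powr (1/4) * (num_divisors n * real n powr (-3/4))"
      by (simp add: mult_ac)
  qed
  also have "\<dots> = 4 * real K powr (1/4) *
      (\<Sum>n | 1 \<le> n \<and> real n \<le> real K. num_divisors n * real n powr (-3/4))"
    unfolding sum_distrib_left by (rule sum.cong) auto
  also have "\<dots> \<le> 4 * real K powr (1/4) * (4 * real K powr (1/4) * (1 + ln K))"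
    using K by (intro mult_left_mono divisor_sum_head) auto
  also have "\<dots> = 16 * sqrt K * (1 + ln K)"
  proof -
    have "real K powr (1/4) * real K powr (1/4) = sqrt K"
      unfolding powr_add[symmetric] by (simp add: powr_half_sqrt)
    then show ?thesis by (simp add: algebra_simps)
  qed
  also have "\<dots> \<le> 16 * (2 * sqrt b) * (1 + ln (2 * b))"
  proof (intro mult_mono add_mono ln_mono)
    have "sqrt K \<le> sqrt (2\<^sup>2 * b)" using K b by (intro real_sqrt_le_mono) auto
    then show "sqrt K \<le> 2 * sqrt b" by (simp add: real_sqrt_mult)
  qed (use K b in auto)
  finally have "\<bar>\<Sum>n=1..K. I n\<bar> \<le> 32 * sqrt b * (1 + ln (2 * b))" by simp
  moreover have "((\<lambda>t. Sigma2 t N) has_integral (\<Sum>n=1..K. I n)) {a..b}"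
  proof (rule has_integral_eq)
    show "((\<lambda>t. \<Sum>n=1..K. ?f n t) has_integral (\<Sum>n=1..K. I n)) {a..b}"
      by (intro has_integral_sum I) auto
    show "(\<Sum>n=1..K. ?f n t) = Sigma2 t N" if "t \<in> {a..b}" for t
      using that a K by (intro Sigma2_eq_sum[symmetric]) auto
  qed
  ultimately show ?thesis using that by blast
qed

section \<open>From means to pointwise bounds\<close>

text \<open>
  The mean square integral is increasing, so \<open>E\<close> falls at most as much as the main term rises. The
  Euler-Mascheroni constant enters only through \<open>2 \<gamma> \<le> 2 + ln 2\<pi>\<close>.
\<close>
lemma E_increment:
  assumes s: "1 \<le> s" "s \<le> t"
  shows "E s \<le> E t + (t - s) * (ln t + 2)"
proof -
  let ?f = "\<lambda>t. (norm (zeta (Complex (1/2) t)))\<^sup>2"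
  define c where "c = 1 + ln (2 * pi) - 2 * (euler_mascheroni :: real)"
  have c: "- c \<le> 1"
  proof -
    have "ln (2 * pi) \<ge> 0" using pi_gt3 by simp
    then show ?thesis unfolding c_def using euler_mascheroni_less_13_over_22 by linarith
  qed
  have "integral {0..s} ?f \<le> integral {0..t} ?f"
    using s by (intro integral_subset_le E_integrand_integrable) auto
  moreover have "(t * ln t - c * t) - (s * ln s - c * s) \<le> (t - s) * (ln t + 2)"
  proof -
    have "s * (ln t - ln s) \<le> s * (t / s - 1)"
      using s ln_le_minus_one[of "t / s"] by (intro mult_left_mono) (auto simp: ln_div)
    also have "\<dots> = t - s" using s by (simp add: field_simps)
    finally have "s * (ln t - ln s) \<le> t - s" .
    moreover have "- c * (t - s) \<le> 1 * (t - s)" using c s by (intro mult_right_mono) auto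
    ultimately show ?thesis by (simp add: algebra_simps)
  qed
  ultimately show ?thesis unfolding E_def c_def[symmetric] by linarith
qed

lemma nat_floor_close:
  fixes T :: real
  assumes T: "1000 \<le> T" "100 * h \<le> T" and t: "T - h \<le> t" "t \<le> T + h"
  shows "0.9 * t \<le> real (nat \<lfloor>T\<rfloor>)" "real (nat \<lfloor>T\<rfloor>) \<le> 1.1 * t" "h \<le> real (nat \<lfloor>T\<rfloor>)"
    "1 \<le> nat \<lfloor>T\<rfloor>" "real (nat \<lfloor>T\<rfloor>) \<le> T"
proof -
  obtain x where x: "x = real (nat \<lfloor>T\<rfloor>)" by simp
  have "x \<le> T" "T - 1 \<le> x" unfolding x using T by linarith+
  then have "0.9 * t \<le> x" "x \<le> 1.1 * t" "h \<le> x" "x \<le> T" "1 \<le> x" using T t by simp_all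
  then show "0.9 * t \<le> real (nat \<lfloor>T\<rfloor>)" "real (nat \<lfloor>T\<rfloor>) \<le> 1.1 * t" "h \<le> real (nat \<lfloor>T\<rfloor>)"
    "1 \<le> nat \<lfloor>T\<rfloor>" "real (nat \<lfloor>T\<rfloor>) \<le> T"
    unfolding x using T(1) by (simp_all del: of_nat_nat add: le_nat_floor)
qed

text \<open>
  The split point for \<open>\<Sigma>\<^sub>1\<close> is \<open>M = H\<close>, which is \<open>T / H\<^sup>2\<close>. In terms of \<open>Q = T^(1/12)\<close> all powers
  of \<open>T\<close> that occur are integral: \<open>H = Q^4\<close>, \<open>T^(1/4) = Q^3\<close> and \<open>sqrt T = Q^6\<close>.
\<close>
lemma Sigma_short_integral:
  fixes T :: real
  defines "H \<equiv> T powr (1/3)"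
  assumes T: "T \<ge> 10 ^ 30" and ab: "b - a = H" "T - H \<le> a" "b \<le> T + H"
  obtains I where "((\<lambda>t. Sigma1 t (nat \<lfloor>T\<rfloor>) + Sigma2 t (nat \<lfloor>T\<rfloor>)) has_integral I) {a..b}"
    "\<bar>I\<bar> \<le> H * (23 * H * (1 + ln T))"
proof -
  let ?N = "nat \<lfloor>T\<rfloor>" and ?L = "ln T"
  define Q where "Q = T powr (1/12)"
  have T0: "T > 0" using T by simp
  have Q0: "Q > 0" using T0 by (simp add: Q_def)
  have Q12: "Q ^ 12 = T" using T0 by (simp add: Q_def powr_power)
  have HQ: "H = Q ^ 4" using T0 by (simp add: Q_def H_def powr_power)
  have Q2: "10 ^ 5 \<le> Q ^ 2"
  proof (rule power_le_imp_le_base)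
    have "(Q ^ 2) ^ Suc 5 = Q ^ 12" by (simp flip: power_mult)
    then show "(10 ^ 5) ^ Suc 5 \<le> (Q ^ 2) ^ Suc 5" using T Q12 by simp
  qed (use Q0 in simp)
  have H: "10 ^ 10 \<le> H" "1000 * H \<le> T"
  proof -
    have "(10 ^ 5) ^ 2 \<le> (Q ^ 2) ^ 2" using Q2 by (intro power_mono) auto
    then show *: "10 ^ 10 \<le> H" by (simp add: HQ flip: power_mult)
    have "1000 * 1 * H \<le> H * H * H" using * by (intro mult_mono) auto
    also have "\<dots> = T" by (simp add: HQ flip: Q12 power_add)
    finally show "1000 * H \<le> T" by simp
  qed
  have T': "1000 \<le> T" "100 * H \<le> T" using T H by simp_all
  have ab': "T - H \<le> b" "a \<le> T + H" using ab H by simp_all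
  note N = nat_floor_close[OF T' ab(2) ab'(2)] nat_floor_close(1)[OF T' ab'(1) ab(3)]
  have a: "0 < a" "a \<le> b" "0 < b" "1 \<le> b" "2 * b \<le> (3/2) ^ 4 * T" "b \<le> 2 * T" "1 \<le> H"
    using ab H T by (auto simp: power_numeral_reduce)
  have a': "real ?N \<le> 4/3 * a" "H \<le> real ?N" using N(2,3) a by (simp_all del: of_nat_nat)
  have L: "?L \<ge> 0" using T by simp
  obtain I1 where I1: "((\<lambda>t. Sigma1 t ?N) has_integral I1) {a..b}"
    "\<bar>I1\<bar> \<le> (b - a) * (2 * b) powr (1/4) * (4 * H powr (1/4) * (1 + ln H))
        + (2 * b) powr (3/4) * (5 * H powr (-1/4) * (1 + ln ?N))"
    by (rule Sigma1_integral[OF a(1,2) a'(1) a(7) a'(2)])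
  obtain I2 where I2: "((\<lambda>t. Sigma2 t ?N) has_integral I2) {a..b}"
    "\<bar>I2\<bar> \<le> 32 * sqrt b * (1 + ln (2 * b))"
    by (rule Sigma2_integral[OF a(1,2,4) N(6)])
  \<comment> \<open>The constant \<open>(3/2)^4\<close> is a generous bound for \<open>2 b / T\<close> with a simple fourth root.\<close>
  have b4: "(2 * b) powr (1/4) \<le> 3/2 * Q ^ 3"
  proof -
    have "(2 * b) powr (1/4) \<le> ((3/2) ^ 4 * T) powr (1/4)"
      using a by (intro powr_mono2) auto
    also have "(3/2) ^ 4 * T = (3/2 * Q ^ 3) ^ 4"
      unfolding Q12[symmetric] power_mult_distrib by (simp flip: power_mult)
    also have "\<dots> = (3/2 * Q ^ 3) powr 4" using Q0 by simp
    also have "\<dots> powr (1/4) = 3/2 * Q ^ 3" unfolding powr_powr using Q0 by simp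
    finally show ?thesis .
  qed
  have "(2 * b) powr (3/4) = ((2 * b) powr (1/4)) ^ 3" using a by (simp add: powr_power)
  also have "\<dots> \<le> (3/2 * Q ^ 3) ^ 3" using b4 by (intro power_mono) auto
  also have "\<dots> = 27/8 * Q ^ 9" by (simp add: power_mult_distrib power_divide flip: power_mult)
  finally have b34: "(2 * b) powr (3/4) \<le> 27/8 * Q ^ 9" .
  have HQ4: "H powr (1/4) = Q" "H powr (-1/4) = 1 / Q"
    using Q0 T0 by (simp_all add: H_def Q_def powr_powr powr_minus_divide)
  have lnH: "ln H \<le> ?L" "ln ?N \<le> ?L" using a H N(4,5) T by (auto intro!: ln_mono simp del: of_nat_nat)
  \<comment> \<open>Small \<open>n\<close> contribute \<open>4 * 3/2\<close>, large \<open>n\<close> contribute \<open>5 * 27/8\<close> to the constant \<open>183/8\<close>.\<close>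
  have "\<bar>I1\<bar> \<le> H * (3/2 * Q ^ 3) * (4 * Q * (1 + ?L)) + (27/8 * Q ^ 9) * (5 * (1 / Q) * (1 + ?L))"
    unfolding ab(1)[symmetric] using a Q0 L lnH N
    by (intro order_trans[OF I1(2)[unfolded HQ4]] add_mono mult_mono b4 b34 mult_nonneg_nonneg) auto
  also have "\<dots> = 183/8 * H * H * (1 + ?L)"
    using Q0 by (simp add: HQ field_simps power_numeral_reduce)
  finally have 1: "\<bar>I1\<bar> \<le> 183/8 * (H * H * (1 + ?L))" by (simp add: mult.assoc)
  have "\<bar>I2\<bar> \<le> 32 * (2 * Q ^ 6) * (4 * (1 + ?L))"
  proof (intro order_trans[OF I2(2)] mult_mono)
    have "(2 * Q ^ 6)\<^sup>2 = 4 * T" by (simp add: power_mult_distrib Q12 flip: power_mult)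
    then show "sqrt b \<le> 2 * Q ^ 6" using a(6) T0 Q0 by (intro real_le_lsqrt) auto
    have "ln (2 * b) \<le> ln (4 * T)" using a by (intro ln_mono) auto
    also have "\<dots> = ln 4 + ?L" using T0 by (simp add: ln_mult)
    also have "ln 4 \<le> (3::real)" using ln_le_minus_one[of 4] by simp
    finally show "1 + ln (2 * b) \<le> 4 * (1 + ?L)" using L by simp
  qed (use a Q0 L in auto)
  also have "\<dots> = 256/100000 * (10 ^ 5 * Q ^ 6 * (1 + ?L))" by simp
  \<comment> \<open>The second sum is smaller by the factor \<open>Q^2\<close>, and \<open>Q^2\<close> is at least \<open>10^5\<close>.\<close>
  also have "\<dots> \<le> 256/100000 * (Q ^ 2 * Q ^ 6 * (1 + ?L))"
    using Q2 Q0 L by (intro mult_left_mono mult_right_mono) auto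
  also have "Q ^ 2 * Q ^ 6 = H * H" by (simp add: HQ flip: power_add)
  finally have 2: "\<bar>I2\<bar> \<le> 256/100000 * (H * H * (1 + ?L))" .
  have "0 \<le> H * H * (1 + ?L)" using L a by simp
  with 1 2 have "\<bar>I1 + I2\<bar> \<le> 23 * (H * H * (1 + ?L))" by linarith
  moreover have "((\<lambda>t. Sigma1 t ?N + Sigma2 t ?N) has_integral (I1 + I2)) {a..b}"
    by (intro has_integral_add I1 I2)
  ultimately show ?thesis using that by (simp add: mult_ac)
qed

text \<open>
  Comparing \<open>E T\<close> with \<open>E t\<close> for \<open>t\<close> to the right of \<open>T\<close> gives the upper bound, and for \<open>t\<close> to the left
  of \<open>T\<close> the lower bound. The comparison is turned into one between \<open>E T\<close> and the two sums before it
  is integrated.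
\<close>
lemma E_bound_by_averaging:
  fixes T err :: real
  assumes T: "T \<ge> 10 ^ 30"
    and err: "\<And>t. T - T powr (1/3) \<le> t \<Longrightarrow> t \<le> T + T powr (1/3) \<Longrightarrow>
       \<bar>E t - Sigma1 t (nat \<lfloor>T\<rfloor>) - Sigma2 t (nat \<lfloor>T\<rfloor>)\<bar> \<le> err"
  shows "\<bar>E T\<bar> \<le> T powr (1/3) * (24 * ln T + 26) + err"
proof -
  define H where "H = T powr (1/3)"
  let ?S = "\<lambda>t. Sigma1 t (nat \<lfloor>T\<rfloor>) + Sigma2 t (nat \<lfloor>T\<rfloor>)" and ?L = "ln T"
  have H0: "H > 0" using T by (simp add: H_def)
  have H: "1 \<le> T - H"
  proof -
    have "H \<le> T powr (1/2)" unfolding H_def using T by (intro powr_mono) auto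
    then have "H \<le> sqrt T" using T by (simp add: powr_half_sqrt)
    moreover have "sqrt T * 2 \<le> sqrt T * sqrt T"
      using T by (intro mult_left_mono real_le_rsqrt) auto
    ultimately have "H * 2 \<le> T" using T by simp
    then show ?thesis using T by simp
  qed
  have incr: "E s \<le> E t + H * (?L + 3)" if "T - H \<le> s" "s \<le> t" "t \<le> T + H" "t - s \<le> H" for s t
  proof -
    have t: "t > 0" "t / T \<le> 2" using that H T by (auto simp: field_simps)
    have "ln t = ?L + ln (t / T)" using t T by (simp add: ln_div)
    also have "ln (t / T) \<le> t / T - 1" using t T by (intro ln_le_minus_one) auto
    finally have "ln t \<le> ?L + 1" using t by linarith
    moreover have "0 \<le> ln t" using that H by simp
    ultimately have "(t - s) * (ln t + 2) \<le> H * (?L + 3)"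
      using that H0 by (intro mult_mono) auto
    moreover have "E s \<le> E t + (t - s) * (ln t + 2)"
      using that H by (intro E_increment) auto
    ultimately show ?thesis by linarith
  qed
  have int_const: "((\<lambda>t. k) has_integral H * k) {a..b}" if "b - a = H" for a b k :: real
    using has_integral_const_real[of k a b] that H0 by simp
  have "E T \<le> H * (24 * ?L + 26) + err"
  proof -
    obtain I where I: "(?S has_integral I) {T..T + H}" "\<bar>I\<bar> \<le> H * (23 * H * (1 + ?L))"
      by (rule Sigma_short_integral[of T "T + H" T]) (use T H0 in \<open>auto simp: H_def\<close>)
    have avg: "((\<lambda>t. ?S t + (err + H * (?L + 3))) has_integral I + H * (err + H * (?L + 3))) {T..T + H}"
      by (intro has_integral_add I int_const) simp
    have pw: "E T \<le> ?S t + (err + H * (?L + 3))" if "t \<in> {T..T + H}" for t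
      using incr[of T t] err[of t] that H0 unfolding H_def[symmetric] by simp
    have "H * E T \<le> I + H * (err + H * (?L + 3))"
      by (rule has_integral_le[OF int_const avg pw]) simp
    also have "\<dots> \<le> H * (23 * H * (1 + ?L)) + H * (err + H * (?L + 3))" using I(2) by linarith
    also have "\<dots> = H * (H * (24 * ?L + 26) + err)" by (simp add: algebra_simps)
    finally show ?thesis using H0 by simp
  qed
  moreover have "- (H * (24 * ?L + 26) + err) \<le> E T"
  proof -
    obtain I where I: "(?S has_integral I) {T - H..T}" "\<bar>I\<bar> \<le> H * (23 * H * (1 + ?L))"
      by (rule Sigma_short_integral[of T T "T - H"]) (use T H0 in \<open>auto simp: H_def\<close>)
    have avg: "((\<lambda>t. ?S t + - (err + H * (?L + 3))) has_integral I + H * - (err + H * (?L + 3))) {T - H..T}"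
      by (intro has_integral_add I int_const) simp
    have pw: "?S t + - (err + H * (?L + 3)) \<le> E T" if "t \<in> {T - H..T}" for t
      using incr[of t T] err[of t] that H0 unfolding H_def[symmetric] by simp
    have "I + H * - (err + H * (?L + 3)) \<le> H * E T"
      by (rule has_integral_le[OF avg int_const pw]) simp
    moreover have "H * - (H * (24 * ?L + 26) + err) =
        - (H * (23 * H * (1 + ?L))) + H * - (err + H * (?L + 3))" by (simp add: algebra_simps)
    ultimately have "H * - (H * (24 * ?L + 26) + err) \<le> H * E T" using I(2) by linarith
    then show ?thesis using H0 by (simp only: mult_le_cancel_left_pos)
  qed
  ultimately show ?thesis unfolding H_def[symmetric] by linarith
qed

lemma ln_ge_64:
  assumes "(10::real) ^ 30 \<le> x"
  shows "64 \<le> ln x"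
proof -
  have "exp (64::real) = exp 1 ^ 64" using exp_of_nat_mult[of 64 "1::real"] by simp
  also have "\<dots> \<le> (272/100) ^ 64" using e_less_272 by (intro power_mono) auto
  also have "\<dots> \<le> (10::real) ^ 30" by (simp add: power_divide)
  finally have "exp 64 \<le> x" using assms by simp
  then show ?thesis using assms by (subst ln_ge_iff) auto
qed

text \<open>
  Equivalently, \<open>x^(1/3) / sqrt (ln x)\<close> is increasing. It follows from
  \<open>(T/T0)^(1/3) \<ge> 1 + ln (T/T0) / 3 \<ge> ln T / ln T0\<close>, as \<open>ln T0 \<ge> 3\<close>.
\<close>
lemma sqrt_ln_le_ratio:
  assumes "10 ^ 30 \<le> T0" "T0 \<le> T"
  shows "sqrt (ln T) \<le> T powr (1/3) / T0 powr (1/3) * sqrt (ln T0)"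
proof -
  let ?l = "ln T0" and ?L = "ln T"
  have l: "64 \<le> ?l" "?l \<le> ?L" using assms ln_ge_64[of T0] by (auto intro!: ln_mono)
  have "?L / ?l = 1 + (?L - ?l) / ?l" using l by (simp add: field_simps)
  also have "\<dots> \<le> 1 + (?L - ?l) / 3" using l by (intro add_left_mono divide_left_mono) auto
  also have "\<dots> \<le> exp ((?L - ?l) / 3)" by (rule exp_ge_add_one_self)
  also have "\<dots> = T powr (1/3) / T0 powr (1/3)"
    using assms by (simp add: powr_def diff_divide_distrib exp_diff)
  finally have r: "?L / ?l \<le> T powr (1/3) / T0 powr (1/3)" .
  have "sqrt ?L * sqrt ?l \<le> sqrt ?L * sqrt ?L" using l by (intro mult_left_mono) auto
  then have "sqrt ?L \<le> sqrt ?L * sqrt ?L / sqrt ?l" using l by (simp add: field_simps)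
  also have "\<dots> = ?L / ?l * sqrt ?l" using l by (simp add: real_div_sqrt field_simps)
  also have "\<dots> \<le> T powr (1/3) / T0 powr (1/3) * sqrt ?l" using r l by (intro mult_right_mono) auto
  finally show ?thesis .
qed

text \<open>
  The factors \<open>sqrt \<pi>\<close> in \<open>frak_a\<close> cancel against \<open>1 / sqrt \<pi>\<close>, and \<open>2.111 \<ge> sqrt \<pi>\<close>.
\<close>
lemma frak_a_ge:
  assumes T0: "T0 \<ge> 10 ^ 30"
  shows "1 + \<bar>a1\<bar> * (sqrt (ln T0) / T0 powr (1/3)) + \<bar>a2\<bar> * (1 / (T0 powr (1/3) * sqrt (ln T0)))
      + \<bar>a3\<bar> * (1 / (T0 powr (1/3) * ln T0 powr (3/2)))
    \<le> 1 / sqrt pi * frak_a a1 a2 a3 T0"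
proof -
  have l: "64 \<le> ln T0" using T0 by (rule ln_ge_64)
  define A where "A = \<bar>a1\<bar> * (sqrt (ln T0) / T0 powr (1/3)) + \<bar>a2\<bar> * (1 / (T0 powr (1/3) * sqrt (ln T0)))
      + \<bar>a3\<bar> * (1 / (T0 powr (1/3) * ln T0 powr (3/2)))"
  have "frak_a a1 a2 a3 T0 = sqrt pi * A + (2.111 + 25.4 * ln (ln T0) / ln T0
      + 6.741 / (T0 powr (1/3) * ln T0 powr (3/2)))"
    by (simp add: frak_a_def A_def real_sqrt_mult add_divide_distrib algebra_simps)
  moreover have "sqrt pi \<le> sqrt (2\<^sup>2)" using pi_less_4 by (intro real_sqrt_le_mono) simp
  then have "sqrt pi \<le> 2.111" by simp
  moreover have "0 \<le> 25.4 * ln (ln T0) / ln T0" using l by simp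
  moreover have "0 \<le> 6.741 / (T0 powr (1/3) * ln T0 powr (3/2))" by simp
  ultimately have "sqrt pi * (1 + A) \<le> frak_a a1 a2 a3 T0"
    unfolding distrib_left mult_1_right by linarith
  then have "1 + A \<le> 1 / sqrt pi * frak_a a1 a2 a3 T0" by (simp add: field_simps)
  then show ?thesis by (simp add: A_def)
qed

theorem theorem3:
  fixes T0 a1 a2 a3 :: real
  assumes "T0 \<ge> 10 ^ 30"
    and "\<And>(t::real) (N::nat). t \<ge> T0 \<Longrightarrow> N \<ge> 1 \<Longrightarrow> 0.9 * t \<le> real N \<Longrightarrow> real N \<le> 1.1 * t \<Longrightarrow>
           \<bar>E t - Sigma1 t N - Sigma2 t N\<bar> \<le> a1 * (ln t)\<^sup>2 + a2 * ln t + a3"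
  shows "\<forall>T::real. T \<ge> 1.1 * T0 \<longrightarrow>
           \<bar>E T\<bar> \<le> (1 / sqrt pi * frak_a a1 a2 a3 T0 + 1 + 2.001 / ln T0 powr (1/3))
                    * T powr (1/3) * ln T powr (5/3)"
proof (intro allI impI)
  fix T :: real assume TT: "T \<ge> 1.1 * T0"
  note T0 = assms(1)
  define H H0 L l where "H = T powr (1/3)" and "H0 = T0 powr (1/3)" and "L = ln T" and "l = ln T0"
  have T: "T \<ge> 10 ^ 30" "T0 \<le> T" using TT T0 by auto
  have l: "64 \<le> l" "l \<le> L" using T T0 by (auto simp: l_def L_def intro!: ln_ge_64 ln_mono)
  have H0: "0 < H0" "H0 \<le> H" using T T0 by (auto simp: H0_def H_def intro!: powr_mono2)
  have H100: "100 * H \<le> T"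
  proof -
    have "100 \<le> T powr (2/3)"
    proof -
      have "(100::real) \<le> (10 ^ 3) powr (2/3)" by (simp flip: powr_numeral add: powr_powr)
      also have "\<dots> \<le> T powr (2/3)" using T by (intro powr_mono2) auto
      finally show ?thesis .
    qed
    then have "100 * H \<le> T powr (2/3) * H" using H0 by (intro mult_right_mono) auto
    also have "\<dots> = T" unfolding H_def powr_add[symmetric] using T by simp
    finally show ?thesis .
  qed
  \<comment> \<open>Passing from \<open>ln t\<close> to \<open>L\<close> costs at most a factor 2, for which the factor \<open>L^(1/6)\<close> of \<open>L^(5/3) = L^(3/2) L^(1/6)\<close> pays.\<close>
  have abs_le: "\<bar>E t - Sigma1 t (nat \<lfloor>T\<rfloor>) - Sigma2 t (nat \<lfloor>T\<rfloor>)\<bar>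
      \<le> 2 * (\<bar>a1\<bar> * L\<^sup>2 + \<bar>a2\<bar> * L + \<bar>a3\<bar>)" if t: "T - H \<le> t" "t \<le> T + H" for t
  proof -
    have t0: "T0 \<le> t" "1 \<le> t" using t H100 TT T0 by simp_all
    have T': "1000 \<le> T" using T by simp
    note N = nat_floor_close[OF T' H100 t]
    have lnt: "0 \<le> ln t" "ln t \<le> L + 1"
    proof -
      show "0 \<le> ln t" using t0 by simp
      have "ln (t / T) \<le> t / T - 1" using t0 T by (intro ln_le_minus_one) auto
      also have "\<dots> \<le> 1" using t H100 T H0 by (simp add: field_simps)
      finally show "ln t \<le> L + 1" using t0 T by (simp add: L_def ln_div)
    qed
    have ln2: "(ln t)\<^sup>2 \<le> 2 * L\<^sup>2"
    proof -
      have "(ln t)\<^sup>2 \<le> (L + 1)\<^sup>2" using lnt by (intro power_mono) auto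
      also have "\<dots> = L\<^sup>2 + (2 * L + 1)" by (simp add: power2_sum)
      also have "2 * L + 1 \<le> L * L" using l mult_right_mono[of 64 L L] by linarith
      finally show ?thesis by (simp add: power2_eq_square)
    qed
    have "\<bar>E t - Sigma1 t (nat \<lfloor>T\<rfloor>) - Sigma2 t (nat \<lfloor>T\<rfloor>)\<bar> \<le> a1 * (ln t)\<^sup>2 + a2 * ln t + a3"
      by (rule assms(2)[OF t0(1) N(4,1,2)])
    also have "\<dots> \<le> \<bar>a1\<bar> * (2 * L\<^sup>2) + \<bar>a2\<bar> * (2 * L) + 2 * \<bar>a3\<bar>"
      using lnt ln2 l by (intro add_mono mult_mono) auto
    finally show ?thesis by (simp add: algebra_simps)
  qed
  have "\<bar>E T\<bar> \<le> H * (24 * L + 26) + 2 * (\<bar>a1\<bar> * L\<^sup>2 + \<bar>a2\<bar> * L + \<bar>a3\<bar>)"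
    unfolding H_def L_def by (rule E_bound_by_averaging[OF T(1) abs_le[unfolded H_def L_def]])
  also have "\<dots> \<le> (1 / sqrt pi * frak_a a1 a2 a3 T0 + 1 + 2.001 / l powr (1/3)) * H * L powr (5/3)"
  proof -
    have "(2::real) = 64 powr (1/6)"
    proof -
      have "(64::real) powr (1/6) = (2 powr 6) powr (1/6)" by simp
      also have "\<dots> = 2" unfolding powr_powr by simp
      finally show ?thesis ..
    qed
    also have "\<dots> \<le> L powr (1/6)" using l by (intro powr_mono2) auto
    finally have L6: "2 \<le> L powr (1/6)" .
    have L53: "L powr (5/3) = L * sqrt L * L powr (1/6)"
    proof -
      have "L * sqrt L * L powr (1/6) = L powr 1 * L powr (1/2) * L powr (1/6)"
        using l by (simp add: powr_half_sqrt)
      also have "\<dots> = L powr (5/3)" unfolding powr_add[symmetric] by simp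
      finally show ?thesis ..
    qed
    have L32: "2 * (L * sqrt L) \<le> L powr (5/3)"
      unfolding L53 using mult_left_mono[OF L6, of "L * sqrt L"] l by simp
    have ratio: "sqrt L \<le> H / H0 * sqrt l"
      using sqrt_ln_le_ratio[OF T0 T(2)] by (simp add: H_def H0_def L_def l_def)
    have HH: "1 \<le> H / H0" using H0 by simp
    have main: "H * (24 * L + 26) \<le> 2 * (H * L powr (5/3))"
    proof -
      have "8 \<le> sqrt L" using l by (intro real_le_rsqrt) auto
      then have "L * 16 \<le> 2 * (L * sqrt L)" using l by simp
      also note L32
      finally have "24 * L + 26 \<le> 2 * L powr (5/3)" using l by linarith
      from mult_left_mono[OF this, of H] H0 show ?thesis by simp
    qed
    have t1: "2 * L\<^sup>2 \<le> sqrt l / H0 * (H * L powr (5/3))"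
    proof -
      have "2 * L\<^sup>2 = sqrt L * (2 * (L * sqrt L))" using l by (simp add: power2_eq_square)
      also have "\<dots> \<le> (H / H0 * sqrt l) * L powr (5/3)"
        using ratio L32 l H0 by (intro mult_mono) auto
      finally show ?thesis by (simp add: mult_ac)
    qed
    have t2: "2 * L \<le> 1 / (H0 * sqrt l) * (H * L powr (5/3))"
    proof -
      have "2 * L * sqrt l \<le> 2 * (L * sqrt L)" using l by simp
      also have "\<dots> \<le> 1 * L powr (5/3)" using L32 by simp
      also have "\<dots> \<le> H / H0 * L powr (5/3)" using HH by (intro mult_right_mono) auto
      finally show ?thesis using l H0 by (simp add: field_simps)
    qed
    have t3: "2 \<le> 1 / (H0 * l powr (3/2)) * (H * L powr (5/3))"
    proof -
      have "2 * l powr (3/2) \<le> 2 * L powr (3/2)" using l by (intro mult_left_mono powr_mono2) auto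
      also have "L powr (3/2) = L powr 1 * L powr (1/2)" unfolding powr_add[symmetric] by simp
      also have "2 * \<dots> \<le> 1 * L powr (5/3)" using L32 l by (simp add: powr_half_sqrt)
      also have "\<dots> \<le> H / H0 * L powr (5/3)" using HH by (intro mult_right_mono) auto
      finally show ?thesis using l H0 by (simp add: field_simps)
    qed
    let ?x = "\<bar>a1\<bar> * (sqrt l / H0)" and ?y = "\<bar>a2\<bar> * (1 / (H0 * sqrt l))"
      and ?z = "\<bar>a3\<bar> * (1 / (H0 * l powr (3/2)))" and ?X = "H * L powr (5/3)"
    have "H * (24 * L + 26) + 2 * (\<bar>a1\<bar> * L\<^sup>2 + \<bar>a2\<bar> * L + \<bar>a3\<bar>)
        = H * (24 * L + 26) + \<bar>a1\<bar> * (2 * L\<^sup>2) + \<bar>a2\<bar> * (2 * L) + \<bar>a3\<bar> * 2"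
      by (simp add: algebra_simps)
    also have "\<dots> \<le> 2 * ?X + \<bar>a1\<bar> * (sqrt l / H0 * ?X) + \<bar>a2\<bar> * (1 / (H0 * sqrt l) * ?X)
        + \<bar>a3\<bar> * (1 / (H0 * l powr (3/2)) * ?X)"
      by (intro add_mono mult_left_mono main t1 t2 t3) auto
    also have "\<dots> = ((1 + ?x + ?y + ?z) + 1 + 0) * ?X"
      by (simp only: distrib_right mult.assoc)
    also have "\<dots> \<le> (1 / sqrt pi * frak_a a1 a2 a3 T0 + 1 + 2.001 / l powr (1/3)) * ?X"
    proof (rule mult_right_mono)
      show "0 \<le> ?X" using H0 by simp
      show "(1 + ?x + ?y + ?z) + 1 + 0 \<le> 1 / sqrt pi * frak_a a1 a2 a3 T0 + 1 + 2.001 / l powr (1/3)"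
        unfolding H0_def l_def by (intro add_mono frak_a_ge[OF T0]) auto
    qed
    finally show ?thesis by (simp add: mult.assoc)
  qed
  finally show "\<bar>E T\<bar> \<le> (1 / sqrt pi * frak_a a1 a2 a3 T0 + 1 + 2.001 / ln T0 powr (1/3))
                    * T powr (1/3) * ln T powr (5/3)"
    unfolding H_def L_def l_def .
qed

end
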